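(* Let $\alpha\in(1,2)$, let $X=(X_t)_{t\ge 0}$ be a real-valued symmetric $\alpha$-stable process and let $L_t^x$ be its local time. Then for any $t\ge 0$ and any $p>\frac{2}{\alpha-1}$, almost surely, the function $x\mapsto L_t^x$ is of bounded $p$-variation.
   Context: The local time $L_t^x$ is the jointly continuous (in $(t,x)$) occupation density of $X$: $\int_0^t\varphi(X_s)\,ds=\int_{\mathbb R}\varphi(x)L_t^x\,dx$ for all bounded Borel $\varphi$. For fixed $t$ and $\omega$ the map $x\mapsto L_t^x(\omega)$ has compact support. A function $f:[x',x'']\to\mathbb R$ is of bounded $p$-variation ($p\ge1$) if $\sup_E\sum_{i=1}^m|f(x_i)-f(x_{i-1})|^p<\infty$, where the supremum is over all finite partitions $E=\{x'=x_0<x_1<\dots<x_m=x''\}$ of $[x',x'']$; a function on $\mathbb R$ is of bounded $p$-variation if this holds on every compact interval $[x',x'']$. *)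

theory Defs
  imports "HOL-Probability.Probability"
begin

text \<open>Time is \<open>[0, \<infinity>)\<close>; a process is a function on all of \<^typ>\<open>real\<close> whose values at negative
  times are irrelevant.\<close>

definition cadlag :: "(real \<Rightarrow> real) \<Rightarrow> bool" where
  "cadlag f \<longleftrightarrow>
     (\<forall>t\<ge>0. continuous (at_right t) f) \<and> (\<forall>t>0. \<exists>l. (f \<longlongrightarrow> l) (at_left t))"

locale levy_process = prob_space M
  for M :: "'a measure" and X :: "real \<Rightarrow> 'a \<Rightarrow> real" +
  assumes random_variable_X: "\<And>t. 0 \<le> t \<Longrightarrow> random_variable borel (X t)"
    and start_zero: "AE \<omega> in M. X 0 \<omega> = 0"
    and independent_increments:
      "\<And>(n::nat) s. 0 \<le> s 0 \<Longrightarrow> strict_mono_on {0..n} s \<Longrightarrow>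
         indep_vars (\<lambda>_. borel) (\<lambda>i \<omega>. X (s (Suc i)) \<omega> - X (s i) \<omega>) {..<n}"
    and stationary_increments:
      "\<And>s t. 0 \<le> s \<Longrightarrow> s \<le> t \<Longrightarrow>
         distr M borel (\<lambda>\<omega>. X t \<omega> - X s \<omega>) = distr M borel (X (t - s))"
    and cadlag_paths: "AE \<omega> in M. cadlag (\<lambda>t. X t \<omega>)"

text \<open>The scale \<open>c\<close> is arbitrary; normalisations such as \<open>c = 1\<close> are special cases.\<close>

locale symmetric_stable_process = levy_process M X
  for M :: "'a measure" and X :: "real \<Rightarrow> 'a \<Rightarrow> real" and \<alpha> :: real +
  assumes char_stable:
    "\<exists>c>0. \<forall>t\<ge>0. \<forall>u. char (distr M borel (X t)) u
                        = complex_of_real (exp (- c * t * \<bar>u\<bar> powr \<alpha>))"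

text \<open>\<open>L t x \<omega>\<close> is $L_t^x(\omega)$. The exceptional null set depends neither on \<open>t\<close> nor on \<open>\<phi>\<close>.
  Using \<^const>\<open>has_bochner_integral\<close> makes the integrability of \<open>\<phi> x * L t x \<omega>\<close> explicit.
  Joint continuity determines \<open>L\<close> up to a null set. Nonnegativity and, as paths are
  bounded on \<open>[0, t]\<close>, compact support of \<open>x \<mapsto> L t x \<omega>\<close> follow almost surely.\<close>

definition is_local_time ::
    "'a measure \<Rightarrow> (real \<Rightarrow> 'a \<Rightarrow> real) \<Rightarrow> (real \<Rightarrow> real \<Rightarrow> 'a \<Rightarrow> real) \<Rightarrow> bool" where
  "is_local_time M X L \<longleftrightarrow> (AE \<omega> in M.
     continuous_on ({0..} \<times> UNIV) (\<lambda>(t, x). L t x \<omega>) \<and>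
     (\<forall>t\<ge>0. \<forall>\<phi>::real \<Rightarrow> real. \<phi> \<in> borel_measurable borel \<longrightarrow> bounded (range \<phi>) \<longrightarrow>
        has_bochner_integral lborel (\<lambda>x. \<phi> x * L t x \<omega>)
          (LINT s:{0..t}|lborel. \<phi> (X s \<omega>))))"

definition bounded_p_variation_on :: "real \<Rightarrow> real \<Rightarrow> real \<Rightarrow> (real \<Rightarrow> real) \<Rightarrow> bool" where
  "bounded_p_variation_on p a b f \<longleftrightarrow>
     bdd_above {(\<Sum>i=1..m. \<bar>f (x i) - f (x (i - 1))\<bar> powr p) |(m::nat) x.
                  x 0 = a \<and> x m = b \<and> strict_mono_on {0..m} x}"

definition bounded_p_variation :: "real \<Rightarrow> (real \<Rightarrow> real) \<Rightarrow> bool" where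
  "bounded_p_variation p f \<longleftrightarrow> (\<forall>a b. a \<le> b \<longrightarrow> bounded_p_variation_on p a b f)"

end

theory Submission
  imports Defs
begin

text \<open>The local time is almost surely locally Hoelder continuous in space with exponent
  \<open>1 / p < (\<alpha> - 1) / 2\<close>, and Hoelder continuity with exponent \<open>1 / p\<close> gives bounded \<open>p\<close>-variation.
  By Kolmogorov's argument on dyadic points it suffices that, for \<open>\<theta> < \<alpha> - 1\<close>, the \<open>2n\<close>-th moment
  of \<open>L t x - L t (x + \<delta>)\<close> is at most a constant times \<open>\<delta> powr (\<theta> * n)\<close>. By Fatou it is enough to
  bound, uniformly in the bump function \<open>\<phi>\<close>, the moments of the integral of \<open>f (X r)\<close> over \<open>(0, t]\<close>,
  where \<open>f = \<phi> - \<phi> (\<cdot> - \<delta>)\<close>. The Markov property expresses the \<open>m\<close>-th moment as \<open>m!\<close> times the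
  expectation of \<open>K m 0 (X 0)\<close>, where \<open>K 0 = 1\<close> and \<open>K (m + 1)\<close> arises from \<open>f * K m\<close> by integrating
  against the transition density over the remaining time. The bound on \<open>K\<close> uses only that the
  time integral of the supremum of the transition density is finite and that its spatial
  increments gain a factor \<open>\<delta> powr \<theta>\<close>, which follows from Fourier inversion of the
  characteristic function.\<close>

section \<open>Dyadic increments, Hoelder continuity and p-variation\<close>

text \<open>The threshold has two sources. Estimating a cosine increment by
  \<open>2 * |u * \<delta>| powr \<theta>\<close> puts \<open>|u| powr \<theta>\<close> under the
  frequency integral, and by scaling the integral of
  \<open>|u| powr \<theta> * exp (- c * r * |u| powr \<alpha>)\<close> is a constant times
  \<open>r powr - ((1 + \<theta>) / \<alpha>)\<close>, which is integrable at \<open>r = 0\<close>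
  exactly when \<open>\<theta> < \<alpha> - 1\<close>. The halving comes from the time-ordered
  product: the difference in a factor \<open>f\<close> is moved either to the transition arriving at
  that time or to the one leaving it. In the second case that transition is used up, and the next
  \<open>f\<close> is estimated by its mass alone. So \<open>2 * n\<close> factors guarantee only
  \<open>n\<close> gains, and Kolmogorov's argument reaches the exponents below
  \<open>\<theta> / 2 - 1 / (2 * n)\<close>; large \<open>n\<close> gives everything below
  \<open>(\<alpha> - 1) / 2\<close>. A second obstacle is measurability: \<open>L t x\<close> is not
  assumed measurable in \<open>\<omega>\<close>, so moments are taken of a measurable version built
  from occupation averages.\<close>

lemma dyadic_approx_bound:
  fixes f :: "real \<Rightarrow> real"
  assumes cont: "continuous_on UNIV f" and C: "0 \<le> C" and \<gamma>: "0 < \<gamma>"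
    and step: "\<And>(k::nat) (j::int). - N \<le> j / 2^k \<Longrightarrow> (j + 1) / 2^k \<le> N \<Longrightarrow>
                 \<bar>f ((j + 1) / 2^k) - f (j / 2^k)\<bar> \<le> C * (2 powr - \<gamma>) ^ k"
    and x: "- real_of_int N \<le> x" "x \<le> real_of_int N"
  shows "\<bar>f x - f (\<lfloor>2^k * x\<rfloor> / 2^k)\<bar> \<le> C * (2 powr - \<gamma>) ^ k / (1 - 2 powr - \<gamma>)"
proof -
  define \<rho> :: real where "\<rho> = 2 powr - \<gamma>"
  have \<rho>: "0 < \<rho>" "\<rho> < 1"
    using \<gamma> unfolding \<rho>_def by (auto simp: powr_less_one)
  define y where "y = (\<lambda>k::nat. \<lfloor>2^k * x\<rfloor> / (2^k::real))"
  have y_le: "y k \<le> x" and y_ge: "- N \<le> y k" and y_gt: "x - 1 / 2^k < y k" for k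
  proof -
    show "y k \<le> x" unfolding y_def by (simp add: field_simps)
    \<comment> \<open>The end point \<open>- N\<close> is dyadic at every level, so rounding down
      never leaves the interval on which \<open>step\<close> is available.\<close>
    have "real_of_int (- N * 2^k) \<le> 2^k * x"
      using mult_left_mono[OF x(1), of "2^k"] by (simp add: mult.commute)
    then have "- N * 2^k \<le> \<lfloor>2^k * x\<rfloor>" by (simp only: le_floor_iff)
    then have "real_of_int (- N * 2^k) \<le> \<lfloor>2^k * x\<rfloor>" by (simp only: of_int_le_iff)
    then show "- N \<le> y k" unfolding y_def by (simp add: field_simps)
    have "2^k * x < \<lfloor>2^k * x\<rfloor> + 1" by linarith
    then have "x < (\<lfloor>2^k * x\<rfloor> + 1) / 2^k" by (simp add: pos_less_divide_eq mult.commute)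
    then show "x - 1 / 2^k < y k" unfolding y_def by (simp add: add_divide_distrib)
  qed
  have y_step: "\<bar>f (y (Suc k)) - f (y k)\<bar> \<le> C * \<rho> ^ Suc k" for k
  proof -
    define j where "j = \<lfloor>2^k * x\<rfloor>"
    \<comment> \<open>Refinement either keeps the approximant or moves it right by one cell of level
      \<open>Suc k\<close>, so it costs at most one instance of \<open>step\<close>.\<close>
    have "\<lfloor>2^Suc k * x\<rfloor> = 2 * j \<or> \<lfloor>2^Suc k * x\<rfloor> = 2 * j + 1"
      unfolding j_def by (simp add: mult.assoc) linarith
    then show ?thesis
    proof
      assume "\<lfloor>2^Suc k * x\<rfloor> = 2 * j"
      then have "y (Suc k) = y k"
        unfolding y_def j_def[symmetric] by simp
      then show ?thesis using C \<rho> by simp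
    next
      assume *: "\<lfloor>2^Suc k * x\<rfloor> = 2 * j + 1"
      have a: "y k = real_of_int (2*j) / 2^Suc k"
        unfolding y_def j_def[symmetric] by simp
      have b: "y (Suc k) = (real_of_int (2*j) + 1) / 2^Suc k"
        unfolding y_def * by simp
      show ?thesis
        using step[of "2*j" "Suc k"] y_ge[of k] y_le[of "Suc k"] x(2) a b
        unfolding \<rho>_def by simp
    qed
  qed
  have tele: "\<bar>f (y (k + n)) - f (y k)\<bar> \<le> C * \<rho> ^ k / (1 - \<rho>)" for n
  proof -
    have "\<bar>f (y (k + n)) - f (y k)\<bar> \<le> C * \<rho> ^ k * (\<Sum>i<n. \<rho> ^ i)"
    proof (induction n)
      case (Suc n)
      have "\<rho> ^ Suc (k + n) \<le> \<rho> ^ (k + n)" using \<rho> by (simp add: mult_le_cancel_right1)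
      then have "C * \<rho> ^ Suc (k + n) \<le> C * \<rho> ^ k * \<rho> ^ n"
        using C by (simp add: power_add mult.assoc mult_left_mono)
      then show ?case using Suc y_step[of "k + n"] by (simp add: distrib_left)
    qed simp
    also have "(\<Sum>i<n. \<rho> ^ i) \<le> 1 / (1 - \<rho>)"
      using sum_le_suminf[of "\<lambda>i. \<rho> ^ i" "{..<n}"] \<rho> by (simp add: suminf_geometric)
    then have "C * \<rho> ^ k * (\<Sum>i<n. \<rho> ^ i) \<le> C * \<rho> ^ k * (1 / (1 - \<rho>))"
      using C \<rho> by (intro mult_left_mono) auto
    finally show ?thesis by simp
  qed
  have "y \<longlonglongrightarrow> x"
  proof (rule tendsto_sandwich)
    have "(\<lambda>k. (1/2::real)^k) \<longlonglongrightarrow> 0" by (rule LIMSEQ_power_zero) simp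
    then show "(\<lambda>k. x - 1 / 2^k) \<longlonglongrightarrow> x"
      using tendsto_diff[OF tendsto_const[of x]] by (fastforce simp: power_one_over)
  qed (auto intro!: always_eventually y_le less_imp_le[OF y_gt])
  then have "(\<lambda>n. y (k + n)) \<longlonglongrightarrow> x"
    by (subst add.commute) (rule LIMSEQ_ignore_initial_segment)
  moreover have "isCont f x" using cont by (simp add: continuous_on_eq_continuous_at)
  ultimately have "(\<lambda>n. \<bar>f (y (k + n)) - f (y k)\<bar>) \<longlonglongrightarrow> \<bar>f x - f (y k)\<bar>"
    by (intro tendsto_intros isCont_tendsto_compose[of x f])
  then have "\<bar>f x - f (y k)\<bar> \<le> C * \<rho> ^ k / (1 - \<rho>)"
    by (rule LIMSEQ_le_const2) (use tele in auto)
  then show ?thesis unfolding y_def \<rho>_def .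
qed

text \<open>Two points with \<open>2 powr - (k + 1) < |x - y|\<close> and
  \<open>|x - y| \<le> 2 powr - k\<close> have equal or adjacent floors at level \<open>k\<close>.
  Passing from \<open>x\<close> to its floor, across to the other floor and up to \<open>y\<close>
  costs a multiple of \<open>2 powr - (\<gamma> * k)\<close>, which is comparable to
  \<open>|x - y| powr \<gamma>\<close>. Distances of at least 1 are absorbed by boundedness on the
  compact interval.\<close>

lemma holder_of_dyadic_increments:
  fixes f :: "real \<Rightarrow> real"
  assumes cont: "continuous_on UNIV f" and C: "0 \<le> C" and \<gamma>: "0 < \<gamma>"
    and step: "\<And>(k::nat) (j::int). - N \<le> j / 2^k \<Longrightarrow> (j + 1) / 2^k \<le> N \<Longrightarrow>
                 \<bar>f ((j + 1) / 2^k) - f (j / 2^k)\<bar> \<le> C * (2 powr - \<gamma>) ^ k"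
  obtains H where "0 \<le> H" and
    "\<And>x y. x \<in> {- real_of_int N..N} \<Longrightarrow> y \<in> {- real_of_int N..N} \<Longrightarrow>
       \<bar>f x - f y\<bar> \<le> H * \<bar>x - y\<bar> powr \<gamma>"
proof -
  define \<rho> :: real where "\<rho> = 2 powr - \<gamma>"
  have \<rho>: "0 < \<rho>" "\<rho> < 1"
    using \<gamma> unfolding \<rho>_def by (auto simp: powr_less_one)
  have "bounded (f ` {- real_of_int N..N})"
    by (intro compact_imp_bounded compact_continuous_image continuous_on_subset[OF cont]) auto
  then obtain S where S: "\<And>x. x \<in> {- real_of_int N..N} \<Longrightarrow> \<bar>f x\<bar> \<le> S"
    unfolding bounded_iff by (metis imageI real_norm_def)
  \<comment> \<open>One increment between adjacent floors plus two approximation tails. Dividing by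
    \<open>\<rho>\<close> in \<open>H\<close> makes up for the one level lost, since
    \<open>|x - y|\<close> is only known to exceed \<open>2 powr - (k + 1)\<close>;
    \<open>2 * |S|\<close> serves distances of at least 1.\<close>
  define H0 where "H0 = C + 2 * C / (1 - \<rho>)"
  define H where "H = H0 / \<rho> + 2 * \<bar>S\<bar>"
  have H0: "0 \<le> H0" using C \<rho> unfolding H0_def by auto
  then have "0 \<le> H0 / \<rho>" using \<rho> by simp
  then have H: "0 \<le> H" "H0 / \<rho> \<le> H" "2 * S \<le> H" unfolding H_def by linarith+
  have main: "\<bar>f x - f y\<bar> \<le> H * \<bar>x - y\<bar> powr \<gamma>"
    if x: "x \<in> {- real_of_int N..N}" and y: "y \<in> {- real_of_int N..N}" and xy: "x < y" for x y
  proof (cases "y - x < 1")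
    case False
    then have "1 \<le> \<bar>x - y\<bar> powr \<gamma>" using \<gamma> by (auto intro!: ge_one_powr_ge_zero)
    then have "H * 1 \<le> H * \<bar>x - y\<bar> powr \<gamma>" using H(1) by (intro mult_left_mono)
    then show ?thesis using S[OF x] S[OF y] H(3) by linarith
  next
    case True
    define k where "k = nat (\<lfloor>- log 2 (y - x)\<rfloor>)"
    have pos: "0 < - log 2 (y - x)" using True xy by (simp add: log_less_zero_cancel_iff)
    have k1: "real k \<le> - log 2 (y - x)" and k2: "- log 2 (y - x) < real k + 1"
      using pos unfolding k_def by (auto simp: of_nat_nat)
    have "log 2 (y - x) \<le> - real k" using k1 by simp
    then have d1: "2^k * (y - x) \<le> 1"
      using xy by (simp add: log_le_iff powr_minus powr_realpow field_simps)
    have "- (real k + 1) < log 2 (y - x)" using k2 by simp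
    then have d2: "2 powr - (real k + 1) < y - x"
      using xy by (simp add: less_log_iff)
    have dx: "\<bar>f x - f (\<lfloor>2^k * x\<rfloor> / 2^k)\<bar> \<le> C * \<rho> ^ k / (1 - \<rho>)"
      unfolding \<rho>_def by (rule dyadic_approx_bound[OF cont C \<gamma> step]) (use x in auto)
    have dy: "\<bar>f y - f (\<lfloor>2^k * y\<rfloor> / 2^k)\<bar> \<le> C * \<rho> ^ k / (1 - \<rho>)"
      unfolding \<rho>_def by (rule dyadic_approx_bound[OF cont C \<gamma> step]) (use y in auto)
    define j where "j = \<lfloor>2^k * x\<rfloor>"
    have "2^k * x \<le> 2^k * y" using xy by simp
    moreover have "2^k * y \<le> 2^k * x + 1" using d1 by (simp add: algebra_simps)
    ultimately have "\<lfloor>2^k * y\<rfloor> = j \<or> \<lfloor>2^k * y\<rfloor> = j + 1"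
      unfolding j_def by linarith
    then have dj: "\<bar>f (\<lfloor>2^k * x\<rfloor> / 2^k) - f (\<lfloor>2^k * y\<rfloor> / 2^k)\<bar> \<le> C * \<rho> ^ k"
    proof
      assume "\<lfloor>2^k * y\<rfloor> = j"
      then show ?thesis using C \<rho> by (simp add: j_def)
    next
      assume *: "\<lfloor>2^k * y\<rfloor> = j + 1"
      have "real_of_int (- N * 2^k) \<le> 2^k * x"
        using mult_left_mono[of "- real_of_int N" x "2^k"] x by (simp add: mult.commute)
      then have "- N * 2^k \<le> j" unfolding j_def by (simp only: le_floor_iff)
      then have "real_of_int (- N * 2^k) \<le> j" by (simp only: of_int_le_iff)
      then have "- N \<le> j / 2^k" by (simp add: field_simps)
      moreover have "real_of_int j + 1 \<le> 2^k * y" using * by linarith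
      then have "(j + 1) / 2^k \<le> y" by (simp add: field_simps)
      then have "(j + 1) / 2^k \<le> N" using y by auto
      ultimately show ?thesis
        using step[of j k] * unfolding \<rho>_def j_def by (simp add: abs_minus_commute)
    qed
    have "\<bar>f x - f y\<bar> \<le> C * \<rho> ^ k + 2 * (C * \<rho> ^ k / (1 - \<rho>))"
      using dx dy dj by linarith
    also have "\<dots> = H0 / \<rho> * \<rho> ^ Suc k"
      using \<rho> unfolding H0_def by (simp add: field_simps)
    also have "\<rho> ^ Suc k = (2 powr - (real k + 1)) powr \<gamma>"
      using powr_realpow[of \<rho> "Suc k"] \<rho>(1) unfolding \<rho>_def
      by (simp add: powr_powr algebra_simps)
    also have "H0 / \<rho> * \<dots> \<le> H * \<bar>x - y\<bar> powr \<gamma>"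
      using d2 xy \<gamma> \<rho> H H0 by (intro mult_mono powr_mono2) auto
    finally show ?thesis .
  qed
  show ?thesis
  proof (rule that[OF H(1)])
    fix x y assume "x \<in> {- real_of_int N..N}" "y \<in> {- real_of_int N..N}"
    then show "\<bar>f x - f y\<bar> \<le> H * \<bar>x - y\<bar> powr \<gamma>"
      using main[of x y] main[of y x] \<gamma>
      by (cases x y rule: linorder_cases) (auto simp: abs_minus_commute)
  qed
qed

text \<open>The \<open>p\<close>-th power of the Hoelder bound is linear in the length of the step,
  so the sum telescopes to a value that does not depend on the partition.\<close>

lemma bounded_p_variation_on_of_holder:
  assumes p: "0 < p" and H: "0 \<le> H"
    and holder: "\<And>x y. x \<in> {a..b} \<Longrightarrow> y \<in> {a..b} \<Longrightarrow> \<bar>f x - f y\<bar> \<le> H * \<bar>x - y\<bar> powr (1 / p)"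
  shows "bounded_p_variation_on p a b f"
  unfolding bounded_p_variation_on_def
proof (rule bdd_aboveI[where M = "H powr p * (b - a)"], safe)
  fix m :: nat and x :: "nat \<Rightarrow> real"
  assume a: "a = x 0" and b: "b = x m" and mono: "strict_mono_on {0..m} x"
  have xin: "x i \<in> {x 0..x m}" if "i \<le> m" for i
    using that mono by (auto intro!: monotone_onD[OF strict_mono_on_imp_mono_on[OF mono]])
  have "(\<Sum>i=1..m. \<bar>f (x i) - f (x (i - 1))\<bar> powr p) \<le> (\<Sum>i=1..m. H powr p * (x i - x (i - 1)))"
  proof (rule sum_mono)
    fix i assume i: "i \<in> {1..m}"
    have lt: "x (i - 1) < x i" using i by (intro strict_mono_onD[OF mono]) auto
    have "\<bar>f (x i) - f (x (i - 1))\<bar> powr p \<le> (H * \<bar>x i - x (i - 1)\<bar> powr (1 / p)) powr p"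
      using i p xin[of i] xin[of "i - 1"] unfolding a b
      by (intro powr_mono2 holder[unfolded a b]) auto
    also have "\<dots> = H powr p * (x i - x (i - 1))"
      using lt p H by (simp add: powr_mult powr_powr)
    finally show "\<bar>f (x i) - f (x (i - 1))\<bar> powr p \<le> H powr p * (x i - x (i - 1))" .
  qed
  also have "\<dots> = H powr p * (x m - x 0)"
    by (induction m) (simp_all add: algebra_simps)
  finally show "(\<Sum>i=1..m. \<bar>f (x i) - f (x (i - 1))\<bar> powr p) \<le> H powr p * (x m - x 0)" .
qed

section \<open>Densities from integrable characteristic functions\<close>

lemma (in pair_sigma_finite) integrable_pair_bound:
  fixes f :: "'a \<times> 'b \<Rightarrow> real" and g :: "'a \<Rightarrow> real" and h :: "'b \<Rightarrow> real"
  assumes f[measurable]: "f \<in> borel_measurable (M1 \<Otimes>\<^sub>M M2)"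
    and g: "integrable M1 g" and h: "integrable M2 h"
    and bound: "\<And>x y. \<bar>f (x, y)\<bar> \<le> g x * h y"
  shows "integrable (M1 \<Otimes>\<^sub>M M2) f"
proof (rule Bochner_Integration.integrable_bound)
  have [measurable]: "g \<in> borel_measurable M1" "h \<in> borel_measurable M2" using g h by auto
  show "integrable (M1 \<Otimes>\<^sub>M M2) (\<lambda>z. g (fst z) * h (snd z))"
    by (rule Fubini_integrable) (use g h in \<open>auto simp: abs_mult\<close>)
  show "AE z in M1 \<Otimes>\<^sub>M M2. norm (f z) \<le> norm (g (fst z) * h (snd z))"
    using bound by (intro AE_I2) (force intro: order_trans[OF _ abs_ge_self])
qed fact

lemma integrable_indicat_Icc [simp]: "integrable lborel (indicat_real {a..b::real})"
  by (simp add: integrable_indicator_iff emeasure_lborel_Icc_eq)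

text \<open>Fourier inversion for a symmetric law: its characteristic function is real and even, so
  the sine part vanishes and this is the candidate for the density.\<close>

definition cos_transform :: "(real \<Rightarrow> real) \<Rightarrow> real \<Rightarrow> real" where
  "cos_transform \<psi> z = (\<integral>u. cos (u * z) * \<psi> u \<partial>lborel) / (2 * pi)"

lemma integrable_cos_mult:
  fixes \<psi> :: "real \<Rightarrow> real"
  assumes "integrable lborel \<psi>"
  shows "integrable lborel (\<lambda>u. cos (u * z) * \<psi> u)"
proof (rule Bochner_Integration.integrable_bound[OF assms])
  have [measurable]: "\<psi> \<in> borel_measurable borel" using assms by auto
  show "(\<lambda>u. cos (u * z) * \<psi> u) \<in> borel_measurable lborel" by measurable
  show "AE x in lborel. norm (cos (x * z) * \<psi> x) \<le> norm (\<psi> x)"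
    by (auto simp: abs_mult intro!: mult_left_le_one_le)
qed

lemma borel_measurable_cos_transform [measurable]:
  assumes [measurable]: "\<psi> \<in> borel_measurable borel"
  shows "cos_transform \<psi> \<in> borel_measurable borel"
  unfolding cos_transform_def[abs_def] by measurable

lemma abs_cos_transform_le:
  assumes "integrable lborel \<psi>"
  shows "\<bar>cos_transform \<psi> z\<bar> \<le> (\<integral>u. \<bar>\<psi> u\<bar> \<partial>lborel)"
proof -
  have "\<bar>\<integral>u. cos (u * z) * \<psi> u \<partial>lborel\<bar> \<le> (\<integral>u. \<bar>\<psi> u\<bar> \<partial>lborel)"
    by (rule integral_abs_bound_integral[OF integrable_cos_mult[OF assms]])
       (use assms in \<open>auto simp: abs_mult intro!: mult_left_le_one_le\<close>)
  also have "\<dots> \<le> (\<integral>u. \<bar>\<psi> u\<bar> \<partial>lborel) * (2 * pi)"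
    using pi_ge_two mult_left_mono[of 1 "2 * pi" "\<integral>u. \<bar>\<psi> u\<bar> \<partial>lborel"] by simp
  finally show ?thesis
    unfolding cos_transform_def by (simp add: divide_le_eq)
qed

lemma isCont_cos_transform:
  assumes "integrable lborel \<psi>"
  shows "isCont (cos_transform \<psi>) z"
proof -
  have [measurable]: "\<psi> \<in> borel_measurable borel" using assms by auto
  have "((\<lambda>y. \<integral>u. cos (u * y) * \<psi> u \<partial>lborel) \<longlongrightarrow> (\<integral>u. cos (u * z) * \<psi> u \<partial>lborel)) (at z)"
  proof (rule tendsto_at_iff_sequentially[THEN iffD2], safe)
    fix y :: "nat \<Rightarrow> real" assume y: "y \<longlonglongrightarrow> z"
    have "(\<lambda>n. \<integral>u. cos (u * y n) * \<psi> u \<partial>lborel) \<longlonglongrightarrow> (\<integral>u. cos (u * z) * \<psi> u \<partial>lborel)"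
    proof (rule integral_dominated_convergence[where w = "\<lambda>u. \<bar>\<psi> u\<bar>"])
      show "AE u in lborel. (\<lambda>n. cos (u * y n) * \<psi> u) \<longlonglongrightarrow> cos (u * z) * \<psi> u"
        using y by (intro AE_I2 tendsto_intros)
    qed (use assms in \<open>auto simp: abs_mult intro!: mult_left_le_one_le\<close>)
    then show "((\<lambda>y. \<integral>u. cos (u * y) * \<psi> u \<partial>lborel) \<circ> y) \<longlonglongrightarrow> (\<integral>u. cos (u * z) * \<psi> u \<partial>lborel)"
      by (simp add: o_def)
  qed
  then show ?thesis
    unfolding cos_transform_def[abs_def] isCont_def by (intro tendsto_intros) auto
qed

lemma integrable_cos_transform_indicator:
  assumes "integrable lborel \<psi>"
  shows "integrable lborel (\<lambda>z. indicator {a..b} z * cos_transform \<psi> z)"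
proof (rule Bochner_Integration.integrable_bound)
  have [measurable]: "\<psi> \<in> borel_measurable borel" using assms by auto
  show "integrable lborel (\<lambda>z. indicator {a..b} z * (\<integral>u. \<bar>\<psi> u\<bar> \<partial>lborel))" by simp
  show "(\<lambda>z. indicator {a..b} z * cos_transform \<psi> z) \<in> borel_measurable lborel" by measurable
qed (auto simp: abs_mult intro!: AE_I2 mult_left_mono abs_cos_transform_le[OF assms]
      order_trans[OF _ abs_ge_self])

context real_distribution
begin

text \<open>Integrability of \<open>\<psi>\<close> allows dominated convergence to remove the
  truncation in Levy's formula. The kernel there is the integral of \<open>exp (- i t z)\<close>
  over \<open>z\<close> in \<open>[a, b]\<close>, and Fubini brings the \<open>z\<close>-integral
  outside. The conditions on the end points stay for now, because absence of atoms is deduced from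
  this formula.\<close>

lemma Levy_inversion_integrable:
  assumes \<psi>: "integrable lborel \<psi>" and char: "\<And>u. char M u = complex_of_real (\<psi> u)"
    and ab: "a \<le> b" "measure M {a} = 0" "measure M {b} = 0"
  shows "measure M {a<..b} = (\<integral>z. indicator {a..b} z * cos_transform \<psi> z \<partial>lborel)"
proof -
  have [measurable]: "\<psi> \<in> borel_measurable borel" using \<psi> by auto
  define F where "F = (\<lambda>t::real. (iexp (-(t * a)) - iexp (-(t * b))) / (\<i> * t) * char M t)"
  have F_bound: "norm (F t) \<le> (b - a) * \<bar>\<psi> t\<bar>" for t
  proof (cases "t = 0")
    case False
    have "norm ((iexp (t * - a) - iexp (t * - b)) / (\<i> * t)) \<le> b - a"
      using Levy_Inversion_aux2[of "- b" "- a" t] ab False by simp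
    then have "norm ((iexp (-(t * a)) - iexp (-(t * b))) / (\<i> * t)) * norm (char M t) \<le> (b - a) * \<bar>\<psi> t\<bar>"
      unfolding char using ab by (intro mult_mono) auto
    then show ?thesis unfolding F_def norm_mult .
  qed (use ab in \<open>simp add: F_def\<close>)
  have F_meas[measurable]: "F \<in> borel_measurable borel"
    unfolding F_def char by measurable
  have F_int: "integrable lborel F"
    by (rule Bochner_Integration.integrable_bound[where f = "\<lambda>t. (b - a) * \<bar>\<psi> t\<bar>"])
       (use F_bound \<psi> in \<open>auto intro: order_trans[OF _ abs_ge_self]\<close>)
  have "(\<lambda>T::nat. (CLBINT t=-real T..real T. F t)) \<longlonglongrightarrow> integral\<^sup>L lborel F"
  proof -
    have "(\<lambda>T::nat. \<integral>t. indicator {-real T..real T} t *\<^sub>R F t \<partial>lborel) \<longlonglongrightarrow> integral\<^sup>L lborel F"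
    proof (rule integral_dominated_convergence[where w = "\<lambda>t. norm (F t)"])
      show "AE t in lborel. (\<lambda>T. indicator {-real T..real T} t *\<^sub>R F t) \<longlonglongrightarrow> F t"
      proof (rule AE_I2)
        fix t :: real
        obtain n :: nat where n: "\<bar>t\<bar> \<le> n" using real_arch_simple by blast
        have "\<forall>\<^sub>F T in sequentially. indicator {-real T..real T} t *\<^sub>R F t = F t"
          using eventually_ge_at_top[of n] by (rule eventually_mono) (use n in \<open>auto simp: indicator_def\<close>)
        then show "(\<lambda>T. indicator {-real T..real T} t *\<^sub>R F t) \<longlonglongrightarrow> F t"
          by (rule tendsto_eventually)
      qed
    qed (use F_int in \<open>auto simp: indicator_def\<close>)
    then show ?thesis
      by (simp add: interval_integral_Icc set_lebesgue_integral_def)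
  qed
  then have "(\<lambda>T::nat. 1 / (2 * pi) * (CLBINT t=-real T..real T. F t)) \<longlonglongrightarrow> 1 / (2 * pi) * integral\<^sup>L lborel F"
    by (intro tendsto_intros)
  moreover have "(\<lambda>T::nat. 1 / (2 * pi) * (CLBINT t=-real T..real T. F t)) \<longlonglongrightarrow> measure M {a<..b}"
    using Levy_Inversion[OF ab] unfolding F_def by simp
  ultimately have "complex_of_real (measure M {a<..b}) = 1 / (2 * pi) * integral\<^sup>L lborel F"
    using LIMSEQ_unique by blast
  then have "measure M {a<..b} = Re (1 / (2 * pi) * integral\<^sup>L lborel F)"
    by (metis Re_complex_of_real)
  also have "\<dots> = (\<integral>t. Re (F t) \<partial>lborel) / (2 * pi)"
    using integral_Re[OF F_int] by (simp add: Re_divide_of_real flip: of_real_mult)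
  also have "(\<integral>t. Re (F t) \<partial>lborel) = (\<integral>t. (\<integral>z. indicator {a..b} z * (cos (t * z) * \<psi> t) \<partial>lborel) \<partial>lborel)"
  proof (rule integral_cong_AE)
    \<comment> \<open>At \<open>t = 0\<close> division by zero makes \<open>F\<close> vanish while
      the integral is \<open>(b - a) * \<psi> 0\<close>; this single point is discarded.\<close>
    show "AE t in lborel. Re (F t) = (\<integral>z. indicator {a..b} z * (cos (t * z) * \<psi> t) \<partial>lborel)"
      using AE_lborel_singleton[of "0::real"]
    proof eventually_elim
      case (elim t)
      have "(\<integral>z. cos (t * z) * indicator {a..b} z \<partial>lborel) = sin (t * b) / t - sin (t * a) / t"
        by (rule integral_FTC_Icc_real[OF ab(1)])
           (use elim in \<open>auto intro!: derivative_eq_intros continuous_intros\<close>)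
      then have I: "(\<integral>z. indicator {a..b} z * (cos (t * z) * \<psi> t) \<partial>lborel)
          = (sin (t * b) / t - sin (t * a) / t) * \<psi> t"
        by (simp add: mult.commute mult.left_commute flip: integral_mult_left_zero)
      have "Re (F t) = (sin (t * b) / t - sin (t * a) / t) * \<psi> t"
        using elim unfolding F_def char
        by (simp add: Re_divide Im_divide Re_exp Im_exp power2_eq_square field_simps)
      then show ?case unfolding I .
    qed
  qed measurable
  also have "\<dots> = (\<integral>z. (\<integral>t. indicator {a..b} z * (cos (t * z) * \<psi> t) \<partial>lborel) \<partial>lborel)"
  proof (rule lborel_pair.Fubini_integral)
    show "integrable (lborel \<Otimes>\<^sub>M lborel) (\<lambda>(z, t). indicator {a..b} z * (cos (t * z) * \<psi> t))"
      by (rule lborel_pair.integrable_pair_bound[where g = "indicator {a..b}" and h = "\<lambda>t. \<bar>\<psi> t\<bar>"])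
         (use \<psi> in \<open>auto simp: abs_mult split: split_indicator intro!: mult_left_le_one_le\<close>)
  qed
  also have "\<dots> / (2 * pi) = (\<integral>z. indicator {a..b} z * cos_transform \<psi> z \<partial>lborel)"
    unfolding cos_transform_def by simp
  finally show ?thesis .
qed

text \<open>Since atoms are countable, atom-free end points exist arbitrarily close to
  \<open>x\<close> on both sides. By inversion the mass between them is at most the length times the
  integral of \<open>|\<psi>|\<close>, hence arbitrarily small.\<close>

lemma no_atoms_if_integrable_char:
  assumes \<psi>: "integrable lborel \<psi>" and char: "\<And>u. char M u = complex_of_real (\<psi> u)"
  shows "measure M {x} = 0"
proof -
  define P where "P = (\<integral>u. \<bar>\<psi> u\<bar> \<partial>lborel)"
  have "measure M {x} \<le> 2 * P * e" if e: "0 < e" for e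
  proof -
    obtain a where a: "a \<in> {x - e<..<x}" "measure M {a} = 0"
      using real_interval_avoid_countable_set[OF _ countable_support, of "x - e" x] e by auto
    obtain b where b: "b \<in> {x<..<x + e}" "measure M {b} = 0"
      using real_interval_avoid_countable_set[OF _ countable_support, of x "x + e"] e by auto
    have "measure M {x} \<le> measure M {a<..b}"
      using a b by (intro finite_measure_mono) auto
    also have "\<dots> = (\<integral>z. indicator {a..b} z * cos_transform \<psi> z \<partial>lborel)"
      using a b by (intro Levy_inversion_integrable[OF \<psi> char]) auto
    also have "\<dots> \<le> (\<integral>z. indicator {a..b} z * P \<partial>lborel)"
      using abs_cos_transform_le[OF \<psi>] unfolding P_def
      by (intro integral_mono integrable_cos_transform_indicator[OF \<psi>] mult_left_mono)
         (auto simp: abs_le_iff)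
    also have "\<dots> = (b - a) * P" using a b by simp
    also have "\<dots> \<le> (2 * e) * P" using a b by (intro mult_right_mono) (auto simp: P_def)
    finally show ?thesis by (simp add: mult_ac)
  qed
  moreover have P: "0 \<le> P" unfolding P_def by simp
  ultimately have "measure M {x} \<le> 0 + e" if "0 < e" for e
  proof -
    \<comment> \<open>The added 1 keeps the denominator positive when \<open>P = 0\<close>.\<close>
    have "measure M {x} \<le> 2 * P * (e / (2 * P + 1))"
      using \<open>\<And>e. 0 < e \<Longrightarrow> measure M {x} \<le> 2 * P * e\<close>[of "e / (2 * P + 1)"] that P
      by (auto simp: add_nonneg_pos)
    also have "\<dots> \<le> e" using that P by (simp add: field_simps)
    finally show ?thesis by simp
  qed
  then have "measure M {x} \<le> 0" by (rule field_le_epsilon)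
  then show ?thesis by (simp add: measure_le_0_iff)
qed

text \<open>By continuity a negative value would persist on a short interval, to which inversion
  would then assign negative probability.\<close>

lemma cos_transform_nonneg:
  assumes \<psi>: "integrable lborel \<psi>" and char: "\<And>u. char M u = complex_of_real (\<psi> u)"
  shows "0 \<le> cos_transform \<psi> x"
proof (rule ccontr)
  assume "\<not> 0 \<le> cos_transform \<psi> x"
  then have neg: "cos_transform \<psi> x < 0" by simp
  have "\<forall>\<^sub>F z in at x. cos_transform \<psi> z < cos_transform \<psi> x / 2"
    using isCont_cos_transform[OF \<psi>, of x] neg unfolding isCont_def
    by (intro order_tendstoD) auto
  then obtain d where d: "0 < d"
    "\<And>z. z \<noteq> x \<Longrightarrow> dist z x < d \<Longrightarrow> cos_transform \<psi> z < cos_transform \<psi> x / 2"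
    unfolding eventually_at by auto
  have le: "cos_transform \<psi> z \<le> cos_transform \<psi> x / 2" if "z \<in> {x..x + d / 2}" for z
    using d(2)[of z] that d(1) neg by (cases "z = x") (auto simp: dist_real_def)
  have "0 \<le> measure M {x<..x + d / 2}" by simp
  also have "\<dots> = (\<integral>z. indicator {x..x + d / 2} z * cos_transform \<psi> z \<partial>lborel)"
    using d by (intro Levy_inversion_integrable[OF \<psi> char] no_atoms_if_integrable_char[OF \<psi> char]) auto
  also have "\<dots> \<le> (\<integral>z. indicator {x..x + d / 2} z * (cos_transform \<psi> x / 2) \<partial>lborel)"
    by (intro integral_mono integrable_cos_transform_indicator[OF \<psi>])
       (use le in \<open>auto simp: integrable_mult_left split: split_indicator\<close>)
  also have "\<dots> = d / 2 * (cos_transform \<psi> x / 2)" using d by simp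
  also have "\<dots> < 0" using d neg by (simp add: mult_pos_neg)
  finally show False by simp
qed

text \<open>Without atoms every end point is admissible in the inversion formula, so both measures
  agree on bounded intervals; half-lines are increasing unions of these and determine the
  measure.\<close>

lemma density_of_integrable_char:
  assumes \<psi>: "integrable lborel \<psi>" and char: "\<And>u. char M u = complex_of_real (\<psi> u)"
  shows "M = density lborel (\<lambda>z. ennreal (cos_transform \<psi> z))" (is "_ = ?D")
proof (rule measure_eqI_lessThan)
  have [measurable]: "\<psi> \<in> borel_measurable borel" using \<psi> by auto
  have Icc: "emeasure M {x<..x + real n} = emeasure ?D {x<..x + real n}" for x and n :: nat
  proof -
    have "emeasure ?D {x<..x + real n}
        = (\<integral>\<^sup>+z. ennreal (indicator {x..x + real n} z * cos_transform \<psi> z) \<partial>lborel)"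
      by (simp add: emeasure_density, intro nn_integral_cong_AE)
         (use AE_lborel_singleton[of x] in eventually_elim, auto split: split_indicator)
    also have "\<dots> = ennreal (\<integral>z. indicator {x..x + real n} z * cos_transform \<psi> z \<partial>lborel)"
      by (intro nn_integral_eq_integral integrable_cos_transform_indicator[OF \<psi>])
         (auto simp: cos_transform_nonneg[OF \<psi> char])
    also have "\<dots> = emeasure M {x<..x + real n}"
      by (subst Levy_inversion_integrable[OF \<psi> char, symmetric])
         (auto simp: no_atoms_if_integrable_char[OF \<psi> char] emeasure_eq_measure)
    finally show ?thesis by simp
  qed
  have Un: "{x<..} = (\<Union>n::nat. {x<..x + real n})" for x :: real
  proof safe
    fix y assume "x < y"
    moreover obtain n :: nat where "y - x \<le> n" using real_arch_simple by blast
    ultimately show "y \<in> (\<Union>n::nat. {x<..x + real n})" by (auto intro!: exI[of _ n])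
  qed auto
  show "emeasure M {x<..} = emeasure ?D {x<..}" for x
    unfolding Un
    by (subst (1 2) SUP_emeasure_incseq[symmetric])
       (auto simp: Icc incseq_def)
qed (auto simp: emeasure_eq_measure)

end

section \<open>Stable transition densities\<close>

lemma integrable_powr_tail:
  fixes s :: real
  assumes "1 < s"
  shows "integrable lborel (\<lambda>u. if \<bar>u\<bar> \<le> 1 then 1 else \<bar>u\<bar> powr - s)"
proof -
  have "((\<lambda>x. x powr - s) has_integral - (1 powr (- s + 1)) / (- s + 1)) {1..}"
    using assms by (intro has_integral_powr_to_inf) auto
  then have "(\<lambda>x. x powr - s) absolutely_integrable_on {1..}"
    by (intro nonnegative_absolutely_integrable_1) auto
  then have tail: "integrable lborel (\<lambda>u. indicator {1..} u * u powr - s)"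
    unfolding set_integrable_def by (subst (asm) integrable_completion) auto
  then have "integrable lborel (\<lambda>u. indicator {1..} (- u) * (- u) powr - s)"
    by (subst (asm) lborel_integrable_real_affine_iff[of "-1" _ 0, symmetric]) auto
  with tail have "integrable lborel (\<lambda>u. indicator {-1..1} u
      + (indicator {1..} u * u powr - s + indicator {1..} (- u) * (- u) powr - s))"
    by (intro Bochner_Integration.integrable_add) auto
  then show ?thesis
    by (rule Bochner_Integration.integrable_bound) (auto intro!: AE_I2 split: split_indicator)
qed

lemma integrable_powr_at_0:
  fixes \<kappa> t :: real
  assumes "\<kappa> < 1"
  shows "set_integrable lborel {0<..t} (\<lambda>r. r powr - \<kappa>)"
proof (cases "0 \<le> t")
  case True
  have "(\<lambda>r. r powr - \<kappa>) integrable_on {0..t}"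
    using assms True by (intro integrable_on_powr_from_0) auto
  then have "(\<lambda>r. r powr - \<kappa>) absolutely_integrable_on {0..t}"
    by (intro nonnegative_absolutely_integrable_1) auto
  then have "set_integrable lborel {0..t} (\<lambda>r. r powr - \<kappa>)"
    unfolding set_integrable_def by (subst (asm) integrable_completion) auto
  then show ?thesis by (rule set_integrable_subset) auto
qed (simp add: set_integrable_def)

text \<open>For \<open>y = c * r * |u| powr \<alpha>\<close> the right-hand side factors into a
  power of time and a power of frequency, which the exponential does not.\<close>

lemma exp_minus_le_powr:
  fixes y \<kappa> :: real
  assumes "0 < y" "0 \<le> \<kappa>" "\<kappa> \<le> 1"
  shows "exp (- y) \<le> y powr - \<kappa>"
proof -
  have "y powr \<kappa> \<le> exp y"
  proof (cases "y \<le> 1")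
    case True
    then have "y powr \<kappa> \<le> 1" using assms by (simp add: powr_le1)
    also have "1 \<le> exp y" using assms by simp
    finally show ?thesis .
  next
    case False
    then have "y powr \<kappa> \<le> y powr 1" using assms by (intro powr_mono) auto
    also have "y powr 1 = y" using assms by simp
    also have "y \<le> exp y" using exp_ge_add_one_self[of y] by linarith
    finally show ?thesis .
  qed
  then show ?thesis
    using assms by (simp add: exp_minus powr_minus le_imp_inverse_le)
qed

text \<open>Interpolation between the Lipschitz bound at distances up to 1 and the trivial bound 2
  beyond; the latter is the origin of the constant.\<close>

lemma abs_cos_diff_le_powr:
  fixes x y \<theta> :: real
  assumes "0 < \<theta>" "\<theta> \<le> 1"
  shows "\<bar>cos x - cos y\<bar> \<le> 2 * \<bar>x - y\<bar> powr \<theta>"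
proof (cases "\<bar>x - y\<bar> \<le> 1")
  case True
  have "\<bar>cos x - cos y\<bar> \<le> \<bar>x - y\<bar>"
  proof -
    have "cos x - cos y = 2 * sin ((x + y) / 2) * sin ((y - x) / 2)"
      by (rule cos_diff_cos)
    then have "\<bar>cos x - cos y\<bar> = 2 * (\<bar>sin ((x + y) / 2)\<bar> * \<bar>sin ((y - x) / 2)\<bar>)"
      by (simp add: abs_mult)
    also have "\<dots> \<le> 2 * (1 * \<bar>(y - x) / 2\<bar>)"
      by (intro mult_left_mono mult_mono abs_sin_x_le_abs_x) auto
    finally show ?thesis by simp
  qed
  also have "\<bar>x - y\<bar> \<le> \<bar>x - y\<bar> powr \<theta>"
    using True assms powr_mono'[of \<theta> 1 "\<bar>x - y\<bar>"] by (cases "x = y") auto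
  finally show ?thesis using powr_ge_zero[of "\<bar>x - y\<bar>" \<theta>] by linarith
next
  case False
  then have "1 \<le> \<bar>x - y\<bar> powr \<theta>" using assms by (simp add: ge_one_powr_ge_zero)
  then show ?thesis using cos_le_one[of x] cos_le_one[of y] cos_ge_minus_one[of x] cos_ge_minus_one[of y]
    by linarith
qed

text \<open>An explicit formula fixes a pointwise version of the density, so that estimates hold at
  every \<open>z\<close> and not just almost everywhere, and joint measurability in time and space
  is immediate.\<close>

definition stable_density :: "real \<Rightarrow> real \<Rightarrow> real \<Rightarrow> real \<Rightarrow> real" where
  "stable_density c \<alpha> r = cos_transform (\<lambda>u. exp (- c * r * \<bar>u\<bar> powr \<alpha>))"

lemma borel_measurable_stable_density [measurable]:
  "(\<lambda>x. stable_density c \<alpha> (fst x) (snd x)) \<in> borel_measurable (borel \<Otimes>\<^sub>M borel)"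
  unfolding stable_density_def cos_transform_def by measurable

lemma stable_density_bounds:
  fixes c \<alpha> \<theta> :: real
  assumes c: "0 < c" and \<alpha>: "1 < \<alpha>" "\<alpha> < 2" and \<theta>: "0 < \<theta>" "\<theta> < \<alpha> - 1"
  obtains \<beta> :: "real \<Rightarrow> real" where
    "\<And>r. 0 \<le> \<beta> r" "\<beta> \<in> borel_measurable borel" "\<And>t. set_integrable lborel {0<..t} \<beta>"
    "\<And>r. 0 < r \<Longrightarrow> integrable lborel (\<lambda>u. exp (- c * r * \<bar>u\<bar> powr \<alpha>))"
    "\<And>r z. 0 < r \<Longrightarrow> \<bar>stable_density c \<alpha> r z\<bar> \<le> \<beta> r"
    "\<And>r z \<delta>. 0 < r \<Longrightarrow>
       \<bar>stable_density c \<alpha> r (z + \<delta>) - stable_density c \<alpha> r z\<bar> \<le> \<bar>\<delta>\<bar> powr \<theta> * \<beta> r"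
proof -
  txt \<open>\<open>exp (- y) \<le> y powr - \<kappa>\<close> with \<open>\<kappa> < 1\<close> keeps \<open>\<beta>\<close> integrable at time 0, while
    \<open>\<alpha> * \<kappa> - \<theta> > 1\<close> keeps the frequency integral finite; both are possible since \<open>\<theta> < \<alpha> - 1\<close>.\<close>
  define \<kappa> where "\<kappa> = ((1 + \<theta>) / \<alpha> + 1) / 2"
  have \<kappa>: "0 < \<kappa>" "\<kappa> < 1" and s: "1 < \<alpha> * \<kappa> - \<theta>"
  proof -
    have "0 < (1 + \<theta>) / \<alpha>" "(1 + \<theta>) / \<alpha> < 1" using \<alpha> \<theta> by (auto simp: divide_less_eq)
    then show "0 < \<kappa>" "\<kappa> < 1" unfolding \<kappa>_def by simp_all
    have "\<alpha> * \<kappa> = ((1 + \<theta>) + \<alpha>) / 2" using \<alpha> unfolding \<kappa>_def by (simp add: field_simps)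
    then show "1 < \<alpha> * \<kappa> - \<theta>" using \<theta> by (simp add: field_simps)
  qed
  define w where "w = (\<lambda>u. if \<bar>u\<bar> \<le> 1 then 1 else \<bar>u\<bar> powr - (\<alpha> * \<kappa> - \<theta>))"
  \<comment> \<open>The summand 1 serves the frequencies \<open>|u| \<le> 1\<close>, where
    \<open>\<psi> r u \<le> 1\<close>; the other summand is the time factor of the power bound at
    higher frequencies.\<close>
  define g where "g = (\<lambda>r. 1 + c powr - \<kappa> * r powr - \<kappa>)"
  have w_int: "integrable lborel w" unfolding w_def by (rule integrable_powr_tail[OF s])
  have w0: "0 \<le> w u" for u unfolding w_def by auto
  have [measurable]: "w \<in> borel_measurable borel" unfolding w_def by measurable
  define \<psi> where "\<psi> = (\<lambda>r u. exp (- c * r * \<bar>u\<bar> powr \<alpha>))"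
  have [measurable]: "\<psi> r \<in> borel_measurable borel" for r unfolding \<psi>_def by measurable
  have \<psi>0: "0 \<le> \<psi> r u" for r u unfolding \<psi>_def by simp
  have g1: "1 \<le> g r" for r unfolding g_def by simp
  have \<psi>_le: "\<psi> r u \<le> g r * w u" and \<psi>_le': "\<bar>u\<bar> powr \<theta> * \<psi> r u \<le> g r * w u" if r: "0 < r" for r u
  proof -
    have "\<psi> r u \<le> g r * w u \<and> \<bar>u\<bar> powr \<theta> * \<psi> r u \<le> g r * w u"
    proof (cases "\<bar>u\<bar> \<le> 1")
      case True
      have "\<psi> r u \<le> 1" using c r unfolding \<psi>_def by simp
      moreover have "\<bar>u\<bar> powr \<theta> \<le> 1" using True \<theta> by (intro powr_le1) auto
      then have "\<bar>u\<bar> powr \<theta> * \<psi> r u \<le> 1 * \<psi> r u" using \<psi>0 by (intro mult_right_mono)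
      ultimately show ?thesis using True g1[of r] unfolding w_def by auto
    next
      case False
      have "\<psi> r u \<le> (c * r * \<bar>u\<bar> powr \<alpha>) powr - \<kappa>"
        using exp_minus_le_powr[of "c * r * \<bar>u\<bar> powr \<alpha>" \<kappa>] c r \<kappa> False unfolding \<psi>_def by simp
      also have "\<dots> = c powr - \<kappa> * r powr - \<kappa> * \<bar>u\<bar> powr - (\<alpha> * \<kappa>)"
        using c r False by (simp add: powr_mult powr_powr)
      also have "\<dots> \<le> g r * \<bar>u\<bar> powr - (\<alpha> * \<kappa>)"
        unfolding g_def by (intro mult_right_mono) auto
      finally have 1: "\<psi> r u \<le> g r * \<bar>u\<bar> powr - (\<alpha> * \<kappa>)" .
      then have "\<bar>u\<bar> powr \<theta> * \<psi> r u \<le> \<bar>u\<bar> powr \<theta> * (g r * \<bar>u\<bar> powr - (\<alpha> * \<kappa>))"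
        by (intro mult_left_mono) auto
      also have "\<dots> = g r * w u"
        using False unfolding w_def by (simp add: powr_diff powr_minus field_simps)
      finally have 2: "\<bar>u\<bar> powr \<theta> * \<psi> r u \<le> g r * w u" .
      have "1 * \<psi> r u \<le> \<bar>u\<bar> powr \<theta> * \<psi> r u"
        using False \<theta> \<psi>0 by (intro mult_right_mono ge_one_powr_ge_zero) auto
      with 2 show ?thesis by simp
    qed
    then show "\<psi> r u \<le> g r * w u" "\<bar>u\<bar> powr \<theta> * \<psi> r u \<le> g r * w u" by auto
  qed
  have \<psi>_int: "integrable lborel (\<psi> r)" if "0 < r" for r
    by (rule Bochner_Integration.integrable_bound[where f = "\<lambda>u. g r * w u"])
       (use w_int \<psi>_le[OF that] \<psi>0 in \<open>auto intro: order_trans[OF _ abs_ge_self]\<close>)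
  have \<psi>'_int: "integrable lborel (\<lambda>u. \<bar>u\<bar> powr \<theta> * \<psi> r u)" if "0 < r" for r
    by (rule Bochner_Integration.integrable_bound[where f = "\<lambda>u. g r * w u"])
       (use w_int \<psi>_le'[OF that] \<psi>0 in \<open>auto intro: order_trans[OF _ abs_ge_self]\<close>)
  define W where "W = integral\<^sup>L lborel w"
  have W: "0 \<le> W" unfolding W_def using w0 by simp
  define \<beta> where "\<beta> = (\<lambda>r. g r * W)"
  show thesis
  proof
    show "0 \<le> \<beta> r" for r using W g1[of r] unfolding \<beta>_def by simp
    show "\<beta> \<in> borel_measurable borel" unfolding \<beta>_def g_def by measurable
    show "set_integrable lborel {0<..t} \<beta>" for t
    proof -
      have "set_integrable lborel {0<..t} (\<lambda>_. 1::real)"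
        by (rule set_integrable_subset[of _ "{0..t}"]) (auto simp: set_integrable_def)
      then show ?thesis
        unfolding \<beta>_def g_def using integrable_powr_at_0[OF \<kappa>(2)]
        by (intro set_integrable_mult_left set_integral_add set_integrable_mult_right) auto
    qed
    show "integrable lborel (\<lambda>u. exp (- c * r * \<bar>u\<bar> powr \<alpha>))" if "0 < r" for r
      using \<psi>_int[OF that] unfolding \<psi>_def .
    show "\<bar>stable_density c \<alpha> r z\<bar> \<le> \<beta> r" if r: "0 < r" for r z
    proof -
      have "\<bar>stable_density c \<alpha> r z\<bar> \<le> (\<integral>u. \<bar>\<psi> r u\<bar> \<partial>lborel)"
        using abs_cos_transform_le[OF \<psi>_int[OF r]] unfolding stable_density_def \<psi>_def .
      also have "\<dots> \<le> (\<integral>u. g r * w u \<partial>lborel)"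
        by (rule integral_mono) (use \<psi>_int[OF r] w_int \<psi>_le[OF r] \<psi>0 in auto)
      finally show ?thesis unfolding \<beta>_def W_def by simp
    qed
    show "\<bar>stable_density c \<alpha> r (z + \<delta>) - stable_density c \<alpha> r z\<bar> \<le> \<bar>\<delta>\<bar> powr \<theta> * \<beta> r"
      if r: "0 < r" for r z \<delta>
    proof -
      define D where "D = (\<integral>u. (cos (u * (z + \<delta>)) - cos (u * z)) * \<psi> r u \<partial>lborel)"
      note int = integrable_cos_mult[OF \<psi>_int[OF r]]
      have "stable_density c \<alpha> r (z + \<delta>) - stable_density c \<alpha> r z = D / (2 * pi)"
        unfolding stable_density_def cos_transform_def D_def
        using Bochner_Integration.integral_diff[OF int int, of "z + \<delta>" z]
        by (simp add: \<psi>_def left_diff_distrib diff_divide_distrib)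
      moreover have "\<bar>D\<bar> \<le> (\<integral>u. 2 * \<bar>\<delta>\<bar> powr \<theta> * (g r * w u) \<partial>lborel)"
        unfolding D_def
      proof (rule integral_abs_bound_integral)
        show "integrable lborel (\<lambda>u. (cos (u * (z + \<delta>)) - cos (u * z)) * \<psi> r u)"
          unfolding left_diff_distrib using int by (intro Bochner_Integration.integrable_diff)
        show "\<bar>(cos (u * (z + \<delta>)) - cos (u * z)) * \<psi> r u\<bar> \<le> 2 * \<bar>\<delta>\<bar> powr \<theta> * (g r * w u)" for u
        proof -
          have "\<bar>cos (u * (z + \<delta>)) - cos (u * z)\<bar> \<le> 2 * \<bar>u * (z + \<delta>) - u * z\<bar> powr \<theta>"
            using \<theta> \<alpha> by (intro abs_cos_diff_le_powr) auto
          also have "u * (z + \<delta>) - u * z = u * \<delta>" by (simp add: algebra_simps)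
          also have "\<bar>u * \<delta>\<bar> powr \<theta> = \<bar>\<delta>\<bar> powr \<theta> * \<bar>u\<bar> powr \<theta>" by (simp add: abs_mult powr_mult)
          finally have "\<bar>(cos (u * (z + \<delta>)) - cos (u * z)) * \<psi> r u\<bar>
              \<le> 2 * (\<bar>\<delta>\<bar> powr \<theta> * \<bar>u\<bar> powr \<theta>) * \<psi> r u"
            using \<psi>0 by (simp add: abs_mult mult_right_mono)
          also have "\<dots> = 2 * \<bar>\<delta>\<bar> powr \<theta> * (\<bar>u\<bar> powr \<theta> * \<psi> r u)" by simp
          also have "\<dots> \<le> 2 * \<bar>\<delta>\<bar> powr \<theta> * (g r * w u)"
            using \<psi>_le'[OF r] by (intro mult_left_mono) auto
          finally show ?thesis .
        qed
      qed (use w_int in auto)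
      moreover have "(\<integral>u. 2 * \<bar>\<delta>\<bar> powr \<theta> * (g r * w u) \<partial>lborel) = 2 * (\<bar>\<delta>\<bar> powr \<theta> * \<beta> r)"
        unfolding \<beta>_def W_def by simp
      \<comment> \<open>The 2 from the cosine estimate is paid for by the normalisation
        \<open>1 / (2 * pi)\<close>, so the same \<open>\<beta>\<close> serves values and
        increments.\<close>
      moreover have "2 * (\<bar>\<delta>\<bar> powr \<theta> * \<beta> r) \<le> 2 * (\<bar>\<delta>\<bar> powr \<theta> * \<beta> r) * pi"
      proof -
        have "0 \<le> \<bar>\<delta>\<bar> powr \<theta> * \<beta> r" using W g1[of r] unfolding \<beta>_def by simp
        then show ?thesis using pi_ge_two mult_left_mono[of 1 pi "2 * (\<bar>\<delta>\<bar> powr \<theta> * \<beta> r)"] by simp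
      qed
      ultimately have "\<bar>D\<bar> \<le> 2 * (\<bar>\<delta>\<bar> powr \<theta> * \<beta> r) * pi" by linarith
      then show ?thesis
        using \<open>stable_density c \<alpha> r (z + \<delta>) - stable_density c \<alpha> r z = D / (2 * pi)\<close>
        by (simp add: divide_le_eq mult_ac)
    qed
  qed
qed

section \<open>Iterated kernels\<close>

lemma integrable_bounded_mult:
  fixes g h :: "real \<Rightarrow> real"
  assumes "integrable lborel g" "h \<in> borel_measurable borel" "\<And>z. \<bar>h z\<bar> \<le> S"
  shows "integrable lborel (\<lambda>z. h z * g z)"
proof (rule Bochner_Integration.integrable_bound[where f = "\<lambda>z. S * g z"])
  have [measurable]: "g \<in> borel_measurable borel" "h \<in> borel_measurable borel" using assms by auto
  show "(\<lambda>z. h z * g z) \<in> borel_measurable lborel" by measurable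
  show "AE z in lborel. norm (h z * g z) \<le> norm (S * g z)"
    using order_trans[OF assms(3) abs_ge_self] by (auto simp: abs_mult intro!: AE_I2 mult_right_mono)
qed (use assms(1) in auto)

text \<open>Separates the kernel estimates from the process. In the application \<open>q\<close> is
  \<open>\<delta> powr \<theta>\<close>. The bump \<open>\<phi>\<close> enters the bounds through
  its total mass 1 and never through its height, so they survive when it shrinks to a point.\<close>

locale kernel_chain =
  fixes p :: "real \<Rightarrow> real \<Rightarrow> real" and \<beta> \<phi> :: "real \<Rightarrow> real" and q \<delta> T B :: real
  assumes p_measurable [measurable]: "(\<lambda>x. p (fst x) (snd x)) \<in> borel_measurable (borel \<Otimes>\<^sub>M borel)"
    and p_bound: "\<And>u z. 0 < u \<Longrightarrow> \<bar>p u z\<bar> \<le> \<beta> u"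
    and p_increment: "\<And>u z. 0 < u \<Longrightarrow> \<bar>p u (z + \<delta>) - p u z\<bar> \<le> q * \<beta> u"
    and \<beta>_nonneg: "\<And>u. 0 \<le> \<beta> u"
    and \<beta>_measurable [measurable]: "\<beta> \<in> borel_measurable borel"
    and \<beta>_integrable: "set_integrable lborel {0<..T} \<beta>"
    and \<beta>_integral: "(LINT u:{0<..T}|lborel. \<beta> u) \<le> B"
    and \<phi>_integrable: "integrable lborel \<phi>"
    and \<phi>_nonneg: "\<And>z. 0 \<le> \<phi> z"
    and \<phi>_integral: "(\<integral>z. \<phi> z \<partial>lborel) = 1"
    and q: "0 \<le> q" "q \<le> 1"
begin

lemma \<phi>_measurable [measurable]: "\<phi> \<in> borel_measurable borel"
  using \<phi>_integrable by auto

definition f :: "real \<Rightarrow> real" where "f z = \<phi> z - \<phi> (z - \<delta>)"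

lemma f_measurable [measurable]: "f \<in> borel_measurable borel"
  unfolding f_def[abs_def] by measurable

text \<open>If \<open>p\<close> is the transition density, this is the expectation of
  \<open>f * h\<close> at the position reached from \<open>z\<close> after time \<open>u\<close>;
  the weight \<open>f\<close> at the arrival point is built in.\<close>

definition transition :: "real \<Rightarrow> (real \<Rightarrow> real) \<Rightarrow> real \<Rightarrow> real" where
  "transition u h z = (\<integral>z'. p u (z' - z) * f z' * h z' \<partial>lborel)"

text \<open>With \<open>p\<close> as transition density this is the integral, over ordered times
  \<open>s < r1 < ... < rm\<close> up to \<open>T\<close>, of the expected product of the values of
  \<open>f\<close> along a path at \<open>z\<close> at time \<open>s\<close>. Time is absolute, with
  \<open>T\<close> as fixed horizon.\<close>

primrec K :: "nat \<Rightarrow> real \<Rightarrow> real \<Rightarrow> real" where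
  "K 0 s z = 1"
| "K (Suc m) s z = (LINT r:{s<..T}|lborel. transition (r - s) (K m r) z)"

lemma \<phi>_shift: "integrable lborel (\<lambda>z. \<phi> (z - \<delta>))" "(\<integral>z. \<phi> (z - \<delta>) \<partial>lborel) = 1"
  using lborel_integrable_real_affine_iff[of 1 \<phi> "- \<delta>"] lborel_integral_real_affine[of 1 \<phi> "- \<delta>"]
    \<phi>_integrable \<phi>_integral by (auto simp: algebra_simps)

lemma p_section_measurable [measurable]: "p u \<in> borel_measurable borel"
  using measurable_compose[OF measurable_Pair1'[of u borel borel] p_measurable] by simp

lemma transition_integrable:
  assumes u: "0 < u" and [measurable]: "h \<in> borel_measurable borel" and h: "\<And>z. \<bar>h z\<bar> \<le> S"
  shows "integrable lborel (\<lambda>z'. p u (z' - z) * f z' * h z')"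
proof -
  have "integrable lborel (\<lambda>z'. (p u (z' - z) * h z') * f z')"
  proof (rule integrable_bounded_mult)
    show "integrable lborel f" unfolding f_def[abs_def] using \<phi>_integrable \<phi>_shift by auto
    show "\<bar>p u (z' - z) * h z'\<bar> \<le> \<beta> u * S" for z'
      unfolding abs_mult using p_bound[OF u] h \<beta>_nonneg by (intro mult_mono) auto
  qed measurable
  then show ?thesis by (simp add: mult_ac)
qed

text \<open>Moving the mass of \<open>\<phi> (\<cdot> - \<delta>)\<close> back by \<open>\<delta>\<close> turns the difference defining \<open>f\<close> into increments
  of the kernel and of \<open>h\<close>.\<close>

lemma transition_bound:
  assumes u: "0 < u" and [measurable]: "h \<in> borel_measurable borel" and h: "\<And>z. \<bar>h z\<bar> \<le> S"
    and inc: "\<And>z. \<bar>h (z + \<delta>) - h z\<bar> \<le> I"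
  shows "\<bar>transition u h z\<bar> \<le> \<beta> u * (I + q * S)"
proof -
  have S: "0 \<le> S" using h[of 0] by linarith
  define g where "g = (\<lambda>w. p u (w - z) * h w)"
  have g: "\<bar>g w\<bar> \<le> \<beta> u * S" for w
    unfolding g_def abs_mult using p_bound[OF u] h \<beta>_nonneg by (intro mult_mono) auto
  have [measurable]: "g \<in> borel_measurable borel" unfolding g_def by measurable
  have i1: "integrable lborel (\<lambda>w. g w * \<phi> w)" and i2: "integrable lborel (\<lambda>w. g w * \<phi> (w - \<delta>))"
    and i3: "integrable lborel (\<lambda>w. g (w + \<delta>) * \<phi> w)"
    using g by (auto intro!: integrable_bounded_mult \<phi>_integrable \<phi>_shift)
  have "transition u h z = (\<integral>w. g w * \<phi> w - g w * \<phi> (w - \<delta>) \<partial>lborel)"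
    unfolding transition_def g_def f_def by (simp add: algebra_simps)
  also have "\<dots> = (\<integral>w. g w * \<phi> w \<partial>lborel) - (\<integral>w. g w * \<phi> (w - \<delta>) \<partial>lborel)"
    using i1 i2 by simp
  also have "(\<integral>w. g w * \<phi> (w - \<delta>) \<partial>lborel) = (\<integral>w. g (w + \<delta>) * \<phi> w \<partial>lborel)"
    by (subst lborel_integral_real_affine[of 1 _ \<delta>]) (auto simp: add.commute)
  also have "(\<integral>w. g w * \<phi> w \<partial>lborel) - (\<integral>w. g (w + \<delta>) * \<phi> w \<partial>lborel)
      = (\<integral>w. (g w - g (w + \<delta>)) * \<phi> w \<partial>lborel)"
    using i1 i3 by (simp add: left_diff_distrib)
  finally have eq: "transition u h z = \<dots>" .
  have "\<bar>\<dots>\<bar> \<le> (\<integral>w. \<beta> u * (I + q * S) * \<phi> w \<partial>lborel)"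
  proof (rule integral_abs_bound_integral)
    show "integrable lborel (\<lambda>w. (g w - g (w + \<delta>)) * \<phi> w)"
      using i1 i3 by (simp add: left_diff_distrib)
    show "\<bar>(g w - g (w + \<delta>)) * \<phi> w\<bar> \<le> \<beta> u * (I + q * S) * \<phi> w" for w
    proof -
      have "g w - g (w + \<delta>) = p u (w - z) * (h w - h (w + \<delta>)) - h (w + \<delta>) * (p u (w - z + \<delta>) - p u (w - z))"
        unfolding g_def by (simp add: algebra_simps)
      also have "\<bar>\<dots>\<bar> \<le> \<bar>p u (w - z)\<bar> * \<bar>h w - h (w + \<delta>)\<bar> + \<bar>h (w + \<delta>)\<bar> * \<bar>p u (w - z + \<delta>) - p u (w - z)\<bar>"
        unfolding abs_mult[symmetric] by (rule abs_triangle_ineq4)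
      also have "\<dots> \<le> \<beta> u * I + S * (q * \<beta> u)"
        using inc[of w] h p_bound[OF u] p_increment[OF u, of "w - z"] S \<beta>_nonneg
        by (intro add_mono mult_mono) (auto simp: abs_minus_commute)
      finally have "\<bar>g w - g (w + \<delta>)\<bar> \<le> \<beta> u * (I + q * S)" by (simp add: algebra_simps)
      then show ?thesis using \<phi>_nonneg[of w] by (simp add: abs_mult mult_right_mono)
    qed
  qed (use \<phi>_integrable in auto)
  then show ?thesis using \<phi>_integral eq by simp
qed

text \<open>Shifting the starting point affects \<open>p\<close> alone and yields the factor
  \<open>q\<close>. The cancellation in \<open>f\<close> is given up: its two bumps are bounded
  separately, whence the total mass 2.\<close>

lemma transition_increment:
  assumes u: "0 < u" and [measurable]: "h \<in> borel_measurable borel" and h: "\<And>z. \<bar>h z\<bar> \<le> S"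
  shows "\<bar>transition u h (z + \<delta>) - transition u h z\<bar> \<le> \<beta> u * (2 * q * S)"
proof -
  note int = transition_integrable[OF assms]
  have eq: "transition u h (z + \<delta>) - transition u h z
      = (\<integral>z'. p u (z' - (z + \<delta>)) * f z' * h z' - p u (z' - z) * f z' * h z' \<partial>lborel)"
    unfolding transition_def by (rule Bochner_Integration.integral_diff[symmetric]) (rule int)+
  have "\<bar>transition u h (z + \<delta>) - transition u h z\<bar> \<le> (\<integral>z'. q * \<beta> u * S * (\<phi> z' + \<phi> (z' - \<delta>)) \<partial>lborel)"
    unfolding eq
  proof (rule integral_abs_bound_integral)
    show "\<bar>p u (z' - (z + \<delta>)) * f z' * h z' - p u (z' - z) * f z' * h z'\<bar>
        \<le> q * \<beta> u * S * (\<phi> z' + \<phi> (z' - \<delta>))" for z'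
    proof -
      have inc: "\<bar>p u (z' - z) - p u (z' - (z + \<delta>))\<bar> \<le> q * \<beta> u"
        using p_increment[OF u, of "z' - (z + \<delta>)"] by simp
      have "p u (z' - (z + \<delta>)) * f z' * h z' - p u (z' - z) * f z' * h z'
          = - (p u (z' - z) - p u (z' - (z + \<delta>))) * h z' * f z'"
        by (simp add: algebra_simps)
      also have "\<bar>\<dots>\<bar> \<le> (q * \<beta> u) * S * (\<phi> z' + \<phi> (z' - \<delta>))"
        unfolding abs_mult abs_minus
        using inc h \<beta>_nonneg q \<phi>_nonneg[of z'] \<phi>_nonneg[of "z' - \<delta>"]
          order_trans[OF abs_ge_zero h]
        by (intro mult_mono) (auto simp: f_def)
      finally show ?thesis .
    qed
    show "integrable lborel (\<lambda>z'. p u (z' - (z + \<delta>)) * f z' * h z' - p u (z' - z) * f z' * h z')"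
      by (intro Bochner_Integration.integrable_diff int)
  qed (use \<phi>_integrable \<phi>_shift in auto)
  also have "\<dots> = q * \<beta> u * S * 2"
    unfolding integral_mult_right_zero Bochner_Integration.integral_add[OF \<phi>_integrable \<phi>_shift(1)]
      \<phi>_integral \<phi>_shift(2) by simp
  finally show ?thesis by (simp only: mult_ac)
qed

lemma transition_measurable [measurable]:
  assumes [measurable]: "(\<lambda>x. h (fst x) (snd x)) \<in> borel_measurable (borel \<Otimes>\<^sub>M borel)"
    and [measurable]: "u \<in> borel_measurable N" "r \<in> borel_measurable N" "z \<in> borel_measurable N"
  shows "(\<lambda>x. transition (u x) (h (r x)) (z x)) \<in> borel_measurable N"
proof -
  have [measurable]: "(\<lambda>y. p (u (fst y)) (snd y - z (fst y))) \<in> borel_measurable (N \<Otimes>\<^sub>M lborel)"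
    "(\<lambda>y. h (r (fst y)) (snd y)) \<in> borel_measurable (N \<Otimes>\<^sub>M lborel)"
    using measurable_compose[OF _ p_measurable, of "\<lambda>y. (u (fst y), snd y - z (fst y))"]
      measurable_compose[OF _ assms(1), of "\<lambda>y. (r (fst y), snd y)"] by simp_all
  show ?thesis unfolding transition_def by measurable
qed

lemma K_measurable [measurable]: "(\<lambda>x. K m (fst x) (snd x)) \<in> borel_measurable (borel \<Otimes>\<^sub>M borel)"
proof (induction m)
  case (Suc m)
  have [measurable]: "(\<lambda>x. transition (snd x - fst (fst x)) (K m (snd x)) (snd (fst x)))
      \<in> borel_measurable ((borel \<Otimes>\<^sub>M borel) \<Otimes>\<^sub>M lborel)"
    by (rule transition_measurable[OF Suc]) measurable
  show ?case
    unfolding K.simps set_lebesgue_integral_def indicator_def greaterThanAtMost_iff by measurable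
qed simp

lemma K_section_measurable [measurable]: "K m s \<in> borel_measurable borel"
  using measurable_compose[OF measurable_Pair1'[of s borel borel] K_measurable] by simp

text \<open>Restarting at \<open>s\<close> only shortens the horizon to \<open>T - s\<close>, so the
  same \<open>B\<close> serves all starting times.\<close>

lemma \<beta>_shift:
  assumes "0 \<le> s"
  shows "set_integrable lborel {s<..T} (\<lambda>r. \<beta> (r - s))" "(LINT r:{s<..T}|lborel. \<beta> (r - s)) \<le> B"
proof -
  have eq: "indicator {s<..T} (s + 1 * r) *\<^sub>R \<beta> (s + 1 * r - s) = indicator {0<..T - s} r *\<^sub>R \<beta> r" for r
    by (auto simp: indicator_def)
  have int: "set_integrable lborel {0<..T - s} \<beta>"
    using assms by (intro set_integrable_subset[OF \<beta>_integrable]) auto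
  then show "set_integrable lborel {s<..T} (\<lambda>r. \<beta> (r - s))"
    using lborel_integrable_real_affine_iff[of 1 "\<lambda>r. indicator {s<..T} r *\<^sub>R \<beta> (r - s)" s]
    unfolding set_integrable_def eq by simp
  have "(LINT r:{s<..T}|lborel. \<beta> (r - s)) = (LINT r:{0<..T - s}|lborel. \<beta> r)"
    using lborel_integral_real_affine[of 1 "\<lambda>r. indicator {s<..T} r *\<^sub>R \<beta> (r - s)" s]
    unfolding set_lebesgue_integral_def eq by simp
  also have "\<dots> \<le> (LINT r:{0<..T}|lborel. \<beta> r)"
    using int \<beta>_integrable \<beta>_nonneg assms unfolding set_lebesgue_integral_def set_integrable_def
    by (intro integral_mono) (auto simp: indicator_def)
  finally show "(LINT r:{s<..T}|lborel. \<beta> (r - s)) \<le> B" using \<beta>_integral by linarith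
qed

lemma set_integral_\<beta>_bound:
  assumes s: "0 \<le> s" and [measurable]: "g \<in> borel_measurable borel" and c: "0 \<le> c"
    and g: "\<And>r. s < r \<Longrightarrow> r \<le> T \<Longrightarrow> \<bar>g r\<bar> \<le> \<beta> (r - s) * c"
  shows "set_integrable lborel {s<..T} g" "\<bar>LINT r:{s<..T}|lborel. g r\<bar> \<le> B * c"
proof -
  have int: "set_integrable lborel {s<..T} (\<lambda>r. \<beta> (r - s) * c)"
    by (rule set_integrable_mult_left) (use \<beta>_shift[OF s] in auto)
  show gint: "set_integrable lborel {s<..T} g"
    using int unfolding set_integrable_def
    by (rule Bochner_Integration.integrable_bound)
       (use g in \<open>auto intro!: AE_I2 split: split_indicator intro: order_trans[OF _ abs_ge_self]\<close>)
  have "\<bar>LINT r:{s<..T}|lborel. g r\<bar> \<le> (LINT r:{s<..T}|lborel. \<beta> (r - s) * c)"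
    using gint int unfolding set_integrable_def set_lebesgue_integral_def
    by (intro integral_abs_bound_integral) (use g in \<open>auto split: split_indicator\<close>)
  also have "\<dots> \<le> B * c"
    using \<beta>_shift(2)[OF s] c by (simp add: mult_right_mono)
  finally show "\<bar>LINT r:{s<..T}|lborel. g r\<bar> \<le> B * c" .
qed

text \<open>The two transition estimates integrated over time. The feedback is crosswise: new values
  inherit the old increments without a further gain, whereas new increments gain \<open>q\<close>
  from the old values.\<close>

lemma K_step:
  assumes S: "\<And>s z. 0 \<le> s \<Longrightarrow> \<bar>K m s z\<bar> \<le> S" and I: "\<And>s z. 0 \<le> s \<Longrightarrow> \<bar>K m s (z + \<delta>) - K m s z\<bar> \<le> I"
    and s: "0 \<le> s"
  shows "\<bar>K (Suc m) s z\<bar> \<le> B * (I + q * S)"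
    and "\<bar>K (Suc m) s (z + \<delta>) - K (Suc m) s z\<bar> \<le> B * (2 * q * S)"
proof -
  have nn: "0 \<le> S" "0 \<le> I" using S[of 0 0] I[of 0 0] by linarith+
  have b1: "\<bar>transition (r - s) (K m r) z\<bar> \<le> \<beta> (r - s) * (I + q * S)" if "s < r" for r z
    using that s by (intro transition_bound S I) auto
  have b2: "\<bar>transition (r - s) (K m r) (z + \<delta>) - transition (r - s) (K m r) z\<bar> \<le> \<beta> (r - s) * (2 * q * S)"
    if "s < r" for r
    using that s by (intro transition_increment S) auto
  have int: "set_integrable lborel {s<..T} (\<lambda>r. transition (r - s) (K m r) z)" for z
    by (rule set_integral_\<beta>_bound[where c = "I + q * S"]) (use s nn q b1 in auto)
  show "\<bar>K (Suc m) s z\<bar> \<le> B * (I + q * S)"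
    unfolding K.simps by (rule set_integral_\<beta>_bound) (use s nn q b1 in auto)
  have eq: "K (Suc m) s (z + \<delta>) - K (Suc m) s z
      = (LINT r:{s<..T}|lborel. transition (r - s) (K m r) (z + \<delta>) - transition (r - s) (K m r) z)"
    unfolding K.simps using int by (simp add: set_integral_diff)
  show "\<bar>K (Suc m) s (z + \<delta>) - K (Suc m) s z\<bar> \<le> B * (2 * q * S)"
    unfolding eq by (rule set_integral_\<beta>_bound) (use s nn q b2 in auto)
qed

text \<open>Increments of \<open>K\<close> are smaller than \<open>K\<close> by a factor \<open>q\<close> only at even levels, so two steps of the
  recursion gain exactly one factor \<open>q\<close>.\<close>

lemma K_even_bound:
  "(\<forall>s\<ge>0. \<forall>z. \<bar>K (2 * i) s z\<bar> \<le> (4 * B\<^sup>2) ^ i * q ^ i) \<and>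
   (\<forall>s\<ge>0. \<forall>z. \<bar>K (2 * i) s (z + \<delta>) - K (2 * i) s z\<bar> \<le> (4 * B\<^sup>2) ^ i * q ^ Suc i)"
proof (induction i)
  case 0
  then show ?case using q by simp
next
  case (Suc i)
  define C where "C = (4 * B\<^sup>2) ^ i * q ^ i"
  have C: "0 \<le> C" using q unfolding C_def by simp
  have S0: "\<bar>K (2 * i) s z\<bar> \<le> C" and I0: "\<bar>K (2 * i) s (z + \<delta>) - K (2 * i) s z\<bar> \<le> q * C"
    if "0 \<le> s" for s z
    using Suc that unfolding C_def by (auto simp: mult_ac)
  have S1: "\<bar>K (Suc (2 * i)) s z\<bar> \<le> 2 * q * B * C" if "0 \<le> s" for s z
    using K_step(1)[OF S0 I0 that, of z] by (simp add: algebra_simps)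
  have I1: "\<bar>K (Suc (2 * i)) s (z + \<delta>) - K (Suc (2 * i)) s z\<bar> \<le> 2 * q * B * C" if "0 \<le> s" for s z
    using K_step(2)[OF S0 I0 that, of z] by (simp add: algebra_simps)
  have "\<bar>K (Suc (Suc (2 * i))) s z\<bar> \<le> 4 * B\<^sup>2 * q * C" if "0 \<le> s" for s z
  proof -
    have "\<bar>K (Suc (Suc (2 * i))) s z\<bar> \<le> B * (2 * q * B * C + q * (2 * q * B * C))"
      by (rule K_step(1)[OF S1 I1 that])
    also have "\<dots> = 2 * B\<^sup>2 * q * C * (1 + q)" by (simp add: power2_eq_square algebra_simps)
    \<comment> \<open>Here \<open>q \<le> 1\<close> enters, and \<open>1 + q \<le> 2\<close>
      completes the constant \<open>4 * B\<^sup>2\<close> per two steps.\<close>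
    also have "\<dots> \<le> 2 * B\<^sup>2 * q * C * 2" using q C by (intro mult_left_mono) auto
    finally show ?thesis by simp
  qed
  moreover have "\<bar>K (Suc (Suc (2 * i))) s (z + \<delta>) - K (Suc (Suc (2 * i))) s z\<bar> \<le> 4 * B\<^sup>2 * q * C * q"
    if "0 \<le> s" for s z
    using K_step(2)[OF S1 I1 that, of z] by (simp add: power2_eq_square mult_ac)
  ultimately show ?case unfolding C_def by (simp add: mult_ac)
qed

text \<open>A qualitative bound at every level, odd ones included, as required by Fubini and the
  Markov step. Increments are carried along because \<open>K_step\<close> feeds on them.\<close>

lemma K_bounded: "\<exists>S. \<forall>s\<ge>0. \<forall>z. \<bar>K m s z\<bar> \<le> S"
proof -
  have "\<exists>S I. (\<forall>s\<ge>0. \<forall>z. \<bar>K m s z\<bar> \<le> S) \<and> (\<forall>s\<ge>0. \<forall>z. \<bar>K m s (z + \<delta>) - K m s z\<bar> \<le> I)"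
  proof (induction m)
    case 0
    then show ?case by (intro exI[of _ 1]) auto
  next
    case (Suc m)
    then obtain S I where "\<forall>s\<ge>0. \<forall>z. \<bar>K m s z\<bar> \<le> S" "\<forall>s\<ge>0. \<forall>z. \<bar>K m s (z + \<delta>) - K m s z\<bar> \<le> I"
      by blast
    then have *: "\<And>s z. 0 \<le> s \<Longrightarrow> \<bar>K m s z\<bar> \<le> S" "\<And>s z. 0 \<le> s \<Longrightarrow> \<bar>K m s (z + \<delta>) - K m s z\<bar> \<le> I"
      by auto
    show ?case using K_step[OF *] by blast
  qed
  then show ?thesis by blast
qed

end

section \<open>Moments of additive functionals\<close>

text \<open>This is \<open>A' = - g\<close> almost everywhere combined with the chain rule for powers; the proof is by
  Fubini, cutting the square along the diagonal, so that no differentiation is needed.\<close>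

lemma power_set_integral:
  fixes g :: "real \<Rightarrow> real" and T :: real
  assumes [measurable]: "g \<in> borel_measurable borel" and F: "\<And>r. \<bar>g r\<bar> \<le> F"
  defines "A \<equiv> \<lambda>s. LINT r:{s<..T}|lborel. g r"
  shows "A s ^ Suc m = real (Suc m) * (LINT r:{s<..T}|lborel. g r * A r ^ m)"
proof (induction m arbitrary: s)
  case 0
  show ?case by (simp add: A_def)
next
  case (Suc m)
  have F0: "0 \<le> F" using F[of 0] by linarith
  have A_meas[measurable]: "A \<in> borel_measurable borel"
    unfolding A_def set_lebesgue_integral_def indicator_def greaterThanAtMost_iff by measurable
  define c where "c = max 0 (T - s)"
  have int_bd: "integrable lborel (\<lambda>x. indicator {s<..T} x * h x)"
    if [measurable]: "h \<in> borel_measurable borel" and "\<And>r. s < r \<Longrightarrow> \<bar>h r\<bar> \<le> C" for h :: "real \<Rightarrow> real" and C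
    by (rule Bochner_Integration.integrable_bound[where f = "\<lambda>x. C * indicator {s..T} x"])
       (use that(2) in \<open>auto split: split_indicator intro!: AE_I2 order_trans[OF _ abs_ge_self]\<close>)
  have A_bd: "\<bar>A r\<bar> \<le> F * c" if "s < r" for r
  proof -
    have "\<bar>A r\<bar> \<le> (\<integral>x. F * indicator {s..T} x \<partial>lborel)"
      unfolding A_def set_lebesgue_integral_def
    proof (rule integral_abs_bound_integral)
      have "set_integrable lborel {s<..T} g"
        unfolding set_integrable_def using int_bd[of g F] F by simp
      then have "set_integrable lborel {r<..T} g"
        by (rule set_integrable_subset) (use that in auto)
      then show "integrable lborel (\<lambda>x. indicator {r<..T} x *\<^sub>R g x)"
        unfolding set_integrable_def .
    qed (use that F F0 in \<open>auto split: split_indicator\<close>)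
    also have "\<dots> \<le> F * c" using F0 by (simp add: c_def max_def mult_left_mono)
    finally show ?thesis .
  qed
  define h where "h = (\<lambda>u. g u * A u ^ m)"
  have [measurable]: "h \<in> borel_measurable borel" unfolding h_def by measurable
  have h_bd: "\<bar>h u\<bar> \<le> F * (F * c) ^ m" if "s < u" for u
    unfolding h_def abs_mult power_abs using F A_bd[OF that] F0 by (intro mult_mono power_mono) auto
  let ?I = "indicator {s<..T} :: real \<Rightarrow> real"
  let ?k = "\<lambda>r u. ?I r * g r * (?I u * h u)"
  have gI: "integrable lborel (\<lambda>r. ?I r * g r)" by (rule int_bd[of g F]) (use F in auto)
  have hI: "integrable lborel (\<lambda>u. ?I u * h u)" by (rule int_bd[of h]) (use h_bd in auto)
  have pair: "integrable (lborel \<Otimes>\<^sub>M lborel) (\<lambda>(r, u). ?k r u * (if P r u then 1 else 0))"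
    if [measurable]: "Measurable.pred (lborel \<Otimes>\<^sub>M lborel) (\<lambda>x. P (fst x) (snd x))" for P
  proof (rule lborel_pair.integrable_pair_bound)
    show "integrable lborel (\<lambda>r. \<bar>?I r * g r\<bar>)" "integrable lborel (\<lambda>u. \<bar>?I u * h u\<bar>)"
      using gI hI by auto
    show "(\<lambda>(r, u). ?k r u * (if P r u then 1 else 0)) \<in> borel_measurable (lborel \<Otimes>\<^sub>M lborel)"
      unfolding case_prod_beta by measurable
  qed (auto simp: abs_mult)
  have sec: "integrable lborel (\<lambda>u. ?k r u * (if P u then 1 else 0))"
    if [measurable]: "Measurable.pred lborel P" for r P
    by (rule Bochner_Integration.integrable_bound[OF integrable_mult_right[OF hI, of "?I r * g r"]])
       (auto simp: abs_mult)
  \<comment> \<open>Above the diagonal the inner integral over \<open>u > r\<close> is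
    \<open>A r ^ Suc m / Suc m\<close> by the induction hypothesis at \<open>r\<close>.\<close>
  have upper: "(\<integral>r. (\<integral>u. ?k r u * (if r < u then 1 else 0) \<partial>lborel) \<partial>lborel)
      = (LINT r:{s<..T}|lborel. g r * A r ^ Suc m) / real (Suc m)"
  proof -
    have "(\<integral>u. ?k r u * (if r < u then 1 else 0) \<partial>lborel)
        = (?I r *\<^sub>R (g r * A r ^ Suc m)) / real (Suc m)" for r
    proof -
      have "(\<integral>u. ?k r u * (if r < u then 1 else 0) \<partial>lborel)
          = ?I r * g r * (\<integral>u. indicator {r<..T} u * h u \<partial>lborel)"
        unfolding integral_mult_right_zero[symmetric]
        by (intro Bochner_Integration.integral_cong refl) (auto split: split_indicator)
      then show ?thesis
        using Suc[of r] unfolding h_def set_lebesgue_integral_def by simp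
    qed
    then show ?thesis unfolding set_lebesgue_integral_def by simp
  qed
  \<comment> \<open>Below the diagonal \<open>r\<close> is integrated first and contributes one more
    factor \<open>A u\<close>. The two halves are \<open>x / Suc m\<close> and \<open>x\<close>,
    which together produce the factor \<open>Suc (Suc m)\<close>.\<close>
  have lower: "(\<integral>r. (\<integral>u. ?k r u * (if u \<le> r then 1 else 0) \<partial>lborel) \<partial>lborel)
      = (LINT u:{s<..T}|lborel. g u * A u ^ Suc m)"
  proof -
    have "(\<integral>r. (\<integral>u. ?k r u * (if u \<le> r then 1 else 0) \<partial>lborel) \<partial>lborel)
        = (\<integral>u. (\<integral>r. ?k r u * (if u \<le> r then 1 else 0) \<partial>lborel) \<partial>lborel)"
      by (rule lborel_pair.Fubini_integral[symmetric]) (rule pair, measurable)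
    also have "\<dots> = (\<integral>u. ?I u *\<^sub>R (g u * A u ^ Suc m) \<partial>lborel)"
    proof (intro Bochner_Integration.integral_cong refl)
      fix u
      have "(\<integral>r. ?k r u * (if u \<le> r then 1 else 0) \<partial>lborel)
          = (\<integral>r. (?I u * h u) * (indicator {u<..T} r *\<^sub>R g r) \<partial>lborel)"
        by (rule integral_cong_AE)
           (measurable, use AE_lborel_singleton[of u] in eventually_elim, auto split: split_indicator)
      then show "(\<integral>r. ?k r u * (if u \<le> r then 1 else 0) \<partial>lborel) = ?I u *\<^sub>R (g u * A u ^ Suc m)"
        unfolding A_def h_def set_lebesgue_integral_def by simp
    qed
    finally show ?thesis unfolding set_lebesgue_integral_def .
  qed
  have "A s ^ Suc (Suc m) = real (Suc m) * ((\<integral>r. ?I r * g r \<partial>lborel) * (\<integral>u. ?I u * h u \<partial>lborel))"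
    using Suc[of s] by (simp add: A_def h_def set_lebesgue_integral_def)
  also have "(\<integral>r. ?I r * g r \<partial>lborel) * (\<integral>u. ?I u * h u \<partial>lborel) = (\<integral>r. (\<integral>u. ?k r u \<partial>lborel) \<partial>lborel)"
    by simp
  also have "\<dots> = (\<integral>r. (\<integral>u. ?k r u * (if r < u then 1 else 0) \<partial>lborel)
      + (\<integral>u. ?k r u * (if u \<le> r then 1 else 0) \<partial>lborel) \<partial>lborel)"
  proof (intro Bochner_Integration.integral_cong refl)
    fix r
    have "(\<integral>u. ?k r u \<partial>lborel) = (\<integral>u. ?k r u * (if r < u then 1 else 0) + ?k r u * (if u \<le> r then 1 else 0) \<partial>lborel)"
      by (intro Bochner_Integration.integral_cong refl) auto
    also have "\<dots> = (\<integral>u. ?k r u * (if r < u then 1 else 0) \<partial>lborel) + (\<integral>u. ?k r u * (if u \<le> r then 1 else 0) \<partial>lborel)"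
      by (intro Bochner_Integration.integral_add sec) measurable
    finally show "(\<integral>u. ?k r u \<partial>lborel) = \<dots>" .
  qed
  also have "\<dots> = (LINT r:{s<..T}|lborel. g r * A r ^ Suc m) / real (Suc m)
      + (LINT u:{s<..T}|lborel. g u * A u ^ Suc m)"
  proof -
    have 1: "integrable lborel (\<lambda>r. \<integral>u. ?k r u * (if r < u then 1 else 0) \<partial>lborel)"
      by (rule lborel_pair.integrable_fst'[OF pair, simplified case_prod_conv]) measurable
    have 2: "integrable lborel (\<lambda>r. \<integral>u. ?k r u * (if u \<le> r then 1 else 0) \<partial>lborel)"
      by (rule lborel_pair.integrable_fst'[OF pair, simplified case_prod_conv]) measurable
    show ?thesis by (simp only: Bochner_Integration.integral_add[OF 1 2] upper lower)
  qed
  finally have "A s ^ Suc (Suc m) = real (Suc m) * \<dots>" .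
  moreover have "real (Suc m) * (x / real (Suc m) + x) = real (Suc (Suc m)) * x" for x
    by (simp add: field_simps)
  ultimately show ?case by (simp only:)
qed

section \<open>The Markov property along finitely many times\<close>

lemma strict_mono_on_nonneg:
  fixes s :: "nat \<Rightarrow> real"
  assumes "strict_mono_on {0..k} s" "s 0 = 0" "i \<le> k"
  shows "0 \<le> s i"
  using mono_onD[OF strict_mono_on_imp_mono_on[OF assms(1)], of 0 i] assms by simp

lemma strict_mono_on_fun_upd_Suc:
  fixes s :: "nat \<Rightarrow> real"
  assumes s: "strict_mono_on {0..k} s" and r: "s k < r"
  shows "strict_mono_on {0..Suc k} (s(Suc k := r))"
proof (rule strict_mono_onI)
  fix i j assume "i \<in> {0..Suc k}" "j \<in> {0..Suc k}" "i < j"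
  moreover have "s i \<le> s k" if "i \<le> k"
    using that mono_onD[OF strict_mono_on_imp_mono_on[OF s], of i k] by simp
  ultimately show "(s(Suc k := r)) i < (s(Suc k := r)) j"
    using strict_mono_onD[OF s, of i j] r by (auto simp: le_Suc_eq)
qed

context levy_process
begin

text \<open>\<open>X\<close> is not assumed to be jointly measurable in time and \<open>\<omega>\<close>; its right limit along dyadic
  times is.\<close>

definition X' :: "real \<Rightarrow> 'a \<Rightarrow> real" where
  "X' s \<omega> = lim (\<lambda>n::nat. X (max 0 ((real_of_int \<lfloor>s * 2^n\<rfloor> + 1) / 2^n)) \<omega>)"

lemma X'_measurable [measurable]: "(\<lambda>x. X' (fst x) (snd x)) \<in> borel_measurable (borel \<Otimes>\<^sub>M M)"
proof -
  have "(\<lambda>x. X (max 0 ((real_of_int \<lfloor>(fst x :: real) * 2^n\<rfloor> + 1) / 2^n)) (snd x)) \<in> borel_measurable (borel \<Otimes>\<^sub>M M)"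
    for n :: nat
  proof (rule measurable_compose_countable[where g = "\<lambda>x. \<lfloor>(fst x :: real) * 2^n\<rfloor>"])
    fix i :: int
    have "X (max 0 ((real_of_int i + 1) / 2^n)) \<in> borel_measurable M"
      by (rule random_variable_X) simp
    then show "(\<lambda>x. X (max 0 ((real_of_int i + 1) / 2^n)) (snd x)) \<in> borel_measurable (borel \<Otimes>\<^sub>M M)"
      by (rule measurable_compose[OF measurable_snd])
  qed measurable
  then show ?thesis unfolding X'_def by (rule borel_measurable_lim_metric)
qed

lemma X'_eq_X: "AE \<omega> in M. \<forall>s\<ge>0. X' s \<omega> = X s \<omega>"
  using cadlag_paths
proof eventually_elim
  case (elim \<omega>)
  show ?case
  proof (intro allI impI)
    fix s :: real assume s: "0 \<le> s"
    define d where "d = (\<lambda>n::nat. max 0 ((real_of_int \<lfloor>s * 2^n\<rfloor> + 1) / 2^n))"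
    have gt: "s < d n" and le: "d n \<le> s + 1 / 2^n" for n
    proof -
      have "s * 2^n < real_of_int \<lfloor>s * 2^n\<rfloor> + 1" by linarith
      then show "s < d n" unfolding d_def by (simp add: less_max_iff_disj less_divide_eq)
      have "real_of_int \<lfloor>s * 2^n\<rfloor> + 1 \<le> s * 2^n + 1" by linarith
      then have "(real_of_int \<lfloor>s * 2^n\<rfloor> + 1) / 2^n \<le> s + 1 / 2^n" by (simp add: field_simps)
      then show "d n \<le> s + 1 / 2^n" using s unfolding d_def by simp
    qed
    have "d \<longlonglongrightarrow> s"
    proof (rule tendsto_sandwich[of "\<lambda>_. s"])
      have "(\<lambda>k. (1/2::real)^k) \<longlonglongrightarrow> 0" by (rule LIMSEQ_power_zero) simp
      then show "(\<lambda>n. s + 1 / 2^n) \<longlonglongrightarrow> s"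
        using tendsto_add[OF tendsto_const[of s]] by (fastforce simp: power_one_over)
    qed (use gt le in \<open>auto intro!: always_eventually less_imp_le\<close>)
    then have "filterlim d (at_right s) sequentially"
      unfolding filterlim_at using gt by (auto intro!: always_eventually)
    moreover have "((\<lambda>t. X t \<omega>) \<longlongrightarrow> X s \<omega>) (at_right s)"
      using elim s unfolding cadlag_def continuous_within by blast
    ultimately have "(\<lambda>n. X (d n) \<omega>) \<longlonglongrightarrow> X s \<omega>" by (rule filterlim_compose[rotated])
    then show "X' s \<omega> = X s \<omega>" unfolding X'_def d_def by (rule limI)
  qed
qed

text \<open>The Markov property without conditional expectations: the product and
  \<open>X (s k)\<close> are functions of the increments up to time \<open>s k\<close>, the last
  increment is independent of these, and stationarity gives it the density
  \<open>p (r - s k)\<close>. Integrating it out first leaves a function of the past.\<close>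

lemma expectation_markov:
  fixes f g :: "real \<Rightarrow> real" and s :: "nat \<Rightarrow> real" and p :: "real \<Rightarrow> real \<Rightarrow> real"
  assumes s: "strict_mono_on {0..k} s" "s 0 = 0" and r: "s k < r"
    and [measurable]: "f \<in> borel_measurable borel" "g \<in> borel_measurable borel"
      "p (r - s k) \<in> borel_measurable borel"
    and f: "\<And>z. \<bar>f z\<bar> \<le> F" and g: "\<And>z. \<bar>g z\<bar> \<le> G"
    and p: "distr M borel (X (r - s k)) = density lborel (\<lambda>z. ennreal (p (r - s k) z))"
      "\<And>z. 0 \<le> p (r - s k) z"
  shows "expectation (\<lambda>\<omega>. (\<Prod>i=1..k. f (X (s i) \<omega>)) * g (X r \<omega>))
       = expectation (\<lambda>\<omega>. (\<Prod>i=1..k. f (X (s i) \<omega>)) * (\<integral>z. p (r - s k) (z - X (s k) \<omega>) * g z \<partial>lborel))"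
proof -
  define s' where "s' = s(Suc k := r)"
  have s': "s' i = s i" if "i \<le> k" for i using that unfolding s'_def by simp
  have s'_mono: "strict_mono_on {0..Suc k} s'"
    unfolding s'_def by (rule strict_mono_on_fun_upd_Suc[OF s(1) r])
  have s_nonneg: "0 \<le> s i" if "i \<le> k" for i
    by (rule strict_mono_on_nonneg[OF s(1,2) that])
  have [measurable]: "X (s i) \<in> borel_measurable M" if "i \<le> k" for i
    using random_variable_X[OF s_nonneg[OF that]] .
  have sk[measurable]: "X (s k) \<in> borel_measurable M" by simp
  have [measurable]: "X r \<in> borel_measurable M"
    using random_variable_X[of r] s_nonneg[of k] r by simp
  define D where "D = (\<lambda>i \<omega>. X (s' (Suc i)) \<omega> - X (s' i) \<omega>)"
  have "indep_vars (\<lambda>_. borel) D {..<Suc k}"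
    unfolding D_def using s'_mono s s'[of 0] by (intro independent_increments) auto
  then have ind: "indep_var (PiM {..<k} (\<lambda>_. borel)) (\<lambda>\<omega>. restrict (\<lambda>i. D i \<omega>) {..<k})
      (PiM {k} (\<lambda>_. borel)) (\<lambda>\<omega>. restrict (\<lambda>i. D i \<omega>) {k})"
    by (rule indep_var_restrict) auto
  \<comment> \<open>Recovers the product and the current position from the increments by partial
    sums; this is valid almost surely because \<open>s 0 = 0\<close> and the process starts at
    0.\<close>
  define P where "P = (\<lambda>v::nat \<Rightarrow> real. (\<Prod>i=1..k. f (\<Sum>j<i. v j), \<Sum>j<k. v j))"
  have P_meas: "P \<in> PiM {..<k} (\<lambda>_. borel) \<rightarrow>\<^sub>M borel \<Otimes>\<^sub>M borel"
  proof -
    have [measurable]: "(\<lambda>v. v j) \<in> PiM {..<k} (\<lambda>_. borel) \<rightarrow>\<^sub>M (borel :: real measure)" if "j < k" for j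
      using that by (intro measurable_component_singleton) auto
    have [measurable]: "(\<lambda>v. \<Sum>j<i. v j) \<in> PiM {..<k} (\<lambda>_. borel) \<rightarrow>\<^sub>M (borel :: real measure)" if "i \<le> k" for i
      using that by (intro borel_measurable_sum) auto
    have "(\<lambda>v. \<Prod>i=1..k. f (\<Sum>j<i. v j)) \<in> PiM {..<k} (\<lambda>_. borel) \<rightarrow>\<^sub>M borel"
      by (intro borel_measurable_prod measurable_compose[OF _ assms(4)]) auto
    then show ?thesis unfolding P_def by measurable
  qed
  define V where "V = (\<lambda>\<omega>. P (\<lambda>i. D i \<omega>))"
  have V_eq: "P (restrict (\<lambda>i. D i \<omega>) {..<k}) = V \<omega>" for \<omega>
    unfolding V_def P_def by (auto intro!: prod.cong arg_cong[where f = f] sum.cong)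
  \<comment> \<open>The dummy component gives \<open>W\<close> the same type as \<open>V\<close>, as
    \<open>indep_var\<close> demands.\<close>
  define W where "W = (\<lambda>\<omega>. (0 :: real, D k \<omega>))"
  have indV: "indep_var (borel \<Otimes>\<^sub>M borel) V (borel \<Otimes>\<^sub>M borel) W"
  proof -
    have [measurable]: "(\<lambda>w. w k) \<in> PiM {k} (\<lambda>_. borel) \<rightarrow>\<^sub>M (borel :: real measure)"
      by (intro measurable_component_singleton) auto
    have "indep_var (borel \<Otimes>\<^sub>M borel) (P \<circ> (\<lambda>\<omega>. restrict (\<lambda>i. D i \<omega>) {..<k}))
        (borel \<Otimes>\<^sub>M borel) ((\<lambda>w. (0, w k)) \<circ> (\<lambda>\<omega>. restrict (\<lambda>i. D i \<omega>) {k}))"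
      by (rule indep_var_compose[OF ind P_meas]) measurable
    then show ?thesis by (simp add: o_def V_eq W_def)
  qed
  have V[measurable]: "V \<in> M \<rightarrow>\<^sub>M borel \<Otimes>\<^sub>M borel" and W[measurable]: "W \<in> M \<rightarrow>\<^sub>M borel \<Otimes>\<^sub>M borel"
    using indV by (auto dest: indep_var_rv1 indep_var_rv2)
  have Dk[measurable]: "D k \<in> borel_measurable M"
    using measurable_compose[OF W measurable_snd] unfolding W_def by simp
  have eq: "distr M (borel \<Otimes>\<^sub>M borel) V \<Otimes>\<^sub>M distr M (borel \<Otimes>\<^sub>M borel) W
      = distr M ((borel \<Otimes>\<^sub>M borel) \<Otimes>\<^sub>M (borel \<Otimes>\<^sub>M borel)) (\<lambda>\<omega>. (V \<omega>, W \<omega>))"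
    using indV by (simp add: indep_var_distribution_eq)
  have distD: "distr M borel (D k) = density lborel (\<lambda>z. ennreal (p (r - s k) z))"
  proof -
    have "D k = (\<lambda>\<omega>. X r \<omega> - X (s k) \<omega>)" unfolding D_def s'_def by auto
    then show ?thesis using stationary_increments[of "s k" r] s_nonneg[of k] r p(1) by simp
  qed
  have path: "AE \<omega> in M. V \<omega> = (\<Prod>i=1..k. f (X (s i) \<omega>), X (s k) \<omega>) \<and> X r \<omega> = X (s k) \<omega> + D k \<omega>"
    using start_zero
  proof eventually_elim
    case (elim \<omega>)
    have "(\<Sum>j<i. D j \<omega>) = X (s i) \<omega>" if "i \<le> k" for i
    proof -
      have "(\<Sum>j<i. D j \<omega>) = X (s' i) \<omega> - X (s' 0) \<omega>"
        unfolding D_def by (rule sum_lessThan_telescope)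
      then show ?thesis using elim s(2) s'[OF that] s'[of 0] by simp
    qed
    then show ?case
      unfolding V_def P_def D_def by (auto simp: s'_def intro!: prod.cong)
  qed
  have V1: "\<bar>fst (V \<omega>)\<bar> \<le> F ^ k" for \<omega>
  proof -
    have "\<bar>fst (V \<omega>)\<bar> \<le> (\<Prod>i=1..k. F)"
      unfolding V_def P_def fst_conv abs_prod using f by (intro prod_mono) auto
    then show ?thesis by simp
  qed
  interpret DV: prob_space "distr M (borel \<Otimes>\<^sub>M borel) V" by (rule prob_space_distr) measurable
  interpret DW: prob_space "distr M (borel \<Otimes>\<^sub>M borel) W" by (rule prob_space_distr) measurable
  interpret P: pair_sigma_finite "distr M (borel \<Otimes>\<^sub>M borel) V" "distr M (borel \<Otimes>\<^sub>M borel) W" ..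
  define h where "h = (\<lambda>x. (fst (fst x) :: real) * g (snd (fst x) + snd (snd x :: real \<times> real)))"
  have [measurable]: "h \<in> borel_measurable ((borel \<Otimes>\<^sub>M borel) \<Otimes>\<^sub>M (borel \<Otimes>\<^sub>M borel))"
    unfolding h_def by measurable
  have "expectation (\<lambda>\<omega>. (\<Prod>i=1..k. f (X (s i) \<omega>)) * g (X r \<omega>)) = expectation (\<lambda>\<omega>. h (V \<omega>, W \<omega>))"
    by (rule integral_cong_AE) (measurable, use path in eventually_elim, auto simp: h_def W_def)
  also have "\<dots> = (\<integral>x. h x \<partial>(distr M (borel \<Otimes>\<^sub>M borel) V \<Otimes>\<^sub>M distr M (borel \<Otimes>\<^sub>M borel) W))"
    unfolding eq by (subst integral_distr) auto
  also have "\<dots> = (\<integral>v. (\<integral>w. h (v, w) \<partial>distr M (borel \<Otimes>\<^sub>M borel) W) \<partial>distr M (borel \<Otimes>\<^sub>M borel) V)"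
  proof (rule P.integral_fst'[symmetric])
    have "integrable M (\<lambda>\<omega>. h (V \<omega>, W \<omega>))"
    proof (rule integrable_const_bound[where B = "F ^ k * G"])
      show "AE \<omega> in M. norm (h (V \<omega>, W \<omega>)) \<le> F ^ k * G"
        using V1 g order_trans[OF abs_ge_zero V1] unfolding h_def
        by (auto simp: abs_mult intro!: AE_I2 mult_mono)
    qed measurable
    then show "integrable (distr M (borel \<Otimes>\<^sub>M borel) V \<Otimes>\<^sub>M distr M (borel \<Otimes>\<^sub>M borel) W) h"
      unfolding eq by (subst integrable_distr_eq) auto
  qed
  also have "\<dots> = (\<integral>v. fst v * (\<integral>z. p (r - s k) (z - snd v) * g z \<partial>lborel) \<partial>distr M (borel \<Otimes>\<^sub>M borel) V)"
  proof (intro Bochner_Integration.integral_cong refl)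
    fix v :: "real \<times> real"
    have [measurable]: "(\<lambda>w. h (v, w)) \<in> borel_measurable (borel \<Otimes>\<^sub>M borel)"
      "(\<lambda>d. h (v, 0, d)) \<in> borel_measurable borel"
      unfolding h_def fst_conv snd_conv by measurable
    have "(\<integral>w. h (v, w) \<partial>distr M (borel \<Otimes>\<^sub>M borel) W) = expectation (\<lambda>\<omega>. h (v, W \<omega>))"
      by (rule integral_distr) measurable
    also have "\<dots> = (\<integral>d. h (v, 0, d) \<partial>distr M borel (D k))"
      unfolding W_def by (rule integral_distr[symmetric]) measurable
    also have "\<dots> = (\<integral>d. p (r - s k) d * h (v, 0, d) \<partial>lborel)"
      unfolding distD by (subst integral_density) (auto simp: p(2))
    also have "\<dots> = (\<integral>z. p (r - s k) (z - snd v) * h (v, 0, z - snd v) \<partial>lborel)"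
      by (subst lborel_integral_real_affine[of 1 _ "- snd v"]) auto
    also have "\<dots> = fst v * (\<integral>z. p (r - s k) (z - snd v) * g z \<partial>lborel)"
      unfolding h_def by (simp add: mult.left_commute)
    finally show "(\<integral>w. h (v, w) \<partial>distr M (borel \<Otimes>\<^sub>M borel) W) = \<dots>" .
  qed
  also have "\<dots> = expectation (\<lambda>\<omega>. fst (V \<omega>) * (\<integral>z. p (r - s k) (z - snd (V \<omega>)) * g z \<partial>lborel))"
    by (subst integral_distr) auto
  also have "\<dots> = expectation (\<lambda>\<omega>. (\<Prod>i=1..k. f (X (s i) \<omega>)) * (\<integral>z. p (r - s k) (z - X (s k) \<omega>) * g z \<partial>lborel))"
    by (rule integral_cong_AE) (measurable, use path in eventually_elim, auto)
  finally show ?thesis .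
qed

end

text \<open>Ties the kernels to the process. The bound \<open>F\<close> on \<open>f\<close> grows as
  the bump shrinks; it serves integrability and does not appear in the resulting moment
  bound.\<close>

locale levy_kernel_chain = levy_process M X + kernel_chain p \<beta> \<phi> q \<delta> T B
  for M :: "'a measure" and X :: "real \<Rightarrow> 'a \<Rightarrow> real" and p \<beta> \<phi> q \<delta> T B +
  fixes F :: real
  assumes p_density: "\<And>u. 0 < u \<Longrightarrow> distr M borel (X u) = density lborel (\<lambda>z. ennreal (p u z))"
    and p_nonneg: "\<And>u z. 0 < u \<Longrightarrow> 0 \<le> p u z"
    and f_bounded: "\<And>z. \<bar>f z\<bar> \<le> F"
begin

definition A :: "real \<Rightarrow> 'a \<Rightarrow> real" where
  "A s \<omega> = (LINT r:{s<..T}|lborel. f (X' r \<omega>))"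

lemma A_measurable [measurable]: "(\<lambda>x. A (fst x) (snd x)) \<in> borel_measurable (borel \<Otimes>\<^sub>M M)"
proof -
  have [measurable]: "(\<lambda>x. X' (snd x) (snd (fst x))) \<in> borel_measurable ((borel \<Otimes>\<^sub>M M) \<Otimes>\<^sub>M lborel)"
    using measurable_compose[OF _ X'_measurable, of "\<lambda>x. (snd x, snd (fst x))" "(borel \<Otimes>\<^sub>M M) \<Otimes>\<^sub>M lborel"]
    by simp
  show ?thesis
    unfolding A_def set_lebesgue_integral_def indicator_def greaterThanAtMost_iff by measurable
qed

lemma A_section_measurable [measurable]: "A s \<in> borel_measurable M"
  using measurable_compose[OF measurable_Pair1'[of s borel M] A_measurable] by simp

lemma X'_section_measurable [measurable]: "X' s \<in> borel_measurable M"
  using measurable_compose[OF measurable_Pair1'[of s borel M] X'_measurable] by simp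

lemma X'_path_measurable: "\<omega> \<in> space M \<Longrightarrow> (\<lambda>s. X' s \<omega>) \<in> borel_measurable borel"
  using measurable_compose[OF measurable_Pair2'[of \<omega> M borel] X'_measurable] by simp

lemma F_nonneg: "0 \<le> F" using f_bounded[of 0] by linarith

text \<open>Holds for every \<open>\<omega>\<close>, as the pointwise domination in Fubini demands.
  Where the path fails to be integrable the integral is 0 by convention.\<close>

lemma A_bound:
  assumes "0 \<le> s" shows "\<bar>A s \<omega>\<bar> \<le> F * \<bar>T\<bar>"
proof (cases "set_integrable lborel {s<..T} (\<lambda>r. f (X' r \<omega>))")
  case True
  then have "\<bar>A s \<omega>\<bar> \<le> (\<integral>r. F * indicator {0..T} r \<partial>lborel)"
    unfolding A_def set_lebesgue_integral_def set_integrable_def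
    using f_bounded F_nonneg assms
    by (intro integral_abs_bound_integral) (auto split: split_indicator)
  also have "\<dots> \<le> F * \<bar>T\<bar>" using F_nonneg by (simp add: mult_left_mono)
  finally show ?thesis .
next
  case False
  then show ?thesis using F_nonneg
    unfolding A_def set_lebesgue_integral_def set_integrable_def
    by (simp add: not_integrable_integral_eq)
qed

text \<open>The earlier times are carried along to make the induction on \<open>m\<close> work.
  Splitting off the earliest time \<open>r\<close> from \<open>A (s k) ^ Suc m\<close> turns
  \<open>f (X r)\<close> into one more factor of the product, so the hypothesis applies with
  \<open>Suc k\<close> times and exponent \<open>m\<close>. The Markov property then integrates out
  \<open>X r\<close>, and the integral over \<open>r\<close> assembles
  \<open>K (Suc m)\<close>.\<close>

lemma moment_formula:
  fixes s :: "nat \<Rightarrow> real"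
  assumes "strict_mono_on {0..k} s" "s 0 = 0" "s k \<le> T"
  shows "expectation (\<lambda>\<omega>. (\<Prod>i=1..k. f (X (s i) \<omega>)) * A (s k) \<omega> ^ m)
       = fact m * expectation (\<lambda>\<omega>. (\<Prod>i=1..k. f (X (s i) \<omega>)) * K m (s k) (X (s k) \<omega>))"
  using assms
proof (induction m arbitrary: k s)
  case 0
  show ?case by simp
next
  case (Suc m)
  interpret pair: pair_sigma_finite lborel M ..
  note s = Suc.prems
  have s_nonneg: "0 \<le> s i" if "i \<le> k" for i
    by (rule strict_mono_on_nonneg[OF s(1,2) that])
  have rv: "X (s i) \<in> borel_measurable M" if "i \<le> k" for i
    using random_variable_X[OF s_nonneg[OF that]] .
  then have [measurable]: "X (s k) \<in> borel_measurable M" by simp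
  define Y where "Y = (\<lambda>\<omega>. \<Prod>i=1..k. f (X (s i) \<omega>))"
  have Y_meas[measurable]: "Y \<in> borel_measurable M"
    unfolding Y_def using rv by (intro borel_measurable_prod measurable_compose[OF _ f_measurable]) auto
  have Y_bd: "\<bar>Y \<omega>\<bar> \<le> F ^ k" for \<omega>
  proof -
    have "\<bar>Y \<omega>\<bar> \<le> (\<Prod>i=1..k. F)"
      unfolding Y_def abs_prod using f_bounded by (intro prod_mono) auto
    then show ?thesis by simp
  qed
  obtain S where S: "\<And>r z. 0 \<le> r \<Longrightarrow> \<bar>K m r z\<bar> \<le> S" using K_bounded[of m] by blast
  have S0: "0 \<le> S" using S[of 0 0] by simp
  have sk: "0 \<le> s k" using s_nonneg by simp
  let ?I = "indicator {s k<..T} :: real \<Rightarrow> real"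
  have meas1[measurable]: "(\<lambda>x. X' (fst x) (snd x)) \<in> borel_measurable (lborel \<Otimes>\<^sub>M M)"
    "(\<lambda>x. A (fst x) (snd x)) \<in> borel_measurable (lborel \<Otimes>\<^sub>M M)"
    using X'_measurable A_measurable by (simp_all cong: measurable_cong_sets)
  have "expectation (\<lambda>\<omega>. Y \<omega> * A (s k) \<omega> ^ Suc m)
      = expectation (\<lambda>\<omega>. real (Suc m) * (\<integral>r. ?I r * (Y \<omega> * (f (X' r \<omega>) * A r \<omega> ^ m)) \<partial>lborel))"
  proof (intro Bochner_Integration.integral_cong refl)
    fix \<omega> assume "\<omega> \<in> space M"
    then have "A (s k) \<omega> ^ Suc m = real (Suc m) * (LINT r:{s k<..T}|lborel. f (X' r \<omega>) * A r \<omega> ^ m)"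
      unfolding A_def
      by (intro power_set_integral[where F = F] measurable_compose[OF X'_path_measurable f_measurable] f_bounded)
    then show "Y \<omega> * A (s k) \<omega> ^ Suc m
        = real (Suc m) * (\<integral>r. ?I r * (Y \<omega> * (f (X' r \<omega>) * A r \<omega> ^ m)) \<partial>lborel)"
      by (simp add: set_lebesgue_integral_def mult.left_commute)
  qed
  also have "\<dots> = real (Suc m) * expectation (\<lambda>\<omega>. \<integral>r. ?I r * (Y \<omega> * (f (X' r \<omega>) * A r \<omega> ^ m)) \<partial>lborel)"
    by (rule integral_mult_right_zero)
  also have "expectation (\<lambda>\<omega>. \<integral>r. ?I r * (Y \<omega> * (f (X' r \<omega>) * A r \<omega> ^ m)) \<partial>lborel)
      = (\<integral>r. expectation (\<lambda>\<omega>. ?I r * (Y \<omega> * (f (X' r \<omega>) * A r \<omega> ^ m))) \<partial>lborel)"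
  proof (rule pair.Fubini_integral)
    show "integrable (lborel \<Otimes>\<^sub>M M) (\<lambda>(r, \<omega>). ?I r * (Y \<omega> * (f (X' r \<omega>) * A r \<omega> ^ m)))"
    proof (rule pair.integrable_pair_bound[where g = "indicator {0..T}" and h = "\<lambda>_. F ^ k * (F * (F * \<bar>T\<bar>) ^ m)"])
      show "(\<lambda>(r, \<omega>). ?I r * (Y \<omega> * (f (X' r \<omega>) * A r \<omega> ^ m))) \<in> borel_measurable (lborel \<Otimes>\<^sub>M M)"
        unfolding case_prod_beta by measurable
      fix r \<omega>
      have "\<bar>Y \<omega> * (f (X' r \<omega>) * A r \<omega> ^ m)\<bar> \<le> F ^ k * (F * (F * \<bar>T\<bar>) ^ m)" if "0 \<le> r"
        unfolding abs_mult power_abs using Y_bd f_bounded A_bound[OF that] F_nonneg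
        by (intro mult_mono power_mono) auto
      then show "\<bar>case (r, \<omega>) of (r, \<omega>) \<Rightarrow> ?I r * (Y \<omega> * (f (X' r \<omega>) * A r \<omega> ^ m))\<bar>
          \<le> indicator {0..T} r * (F ^ k * (F * (F * \<bar>T\<bar>) ^ m))"
        using sk F_nonneg by (auto split: split_indicator)
    qed auto
  qed
  also have "\<dots> = (\<integral>r. expectation (\<lambda>\<omega>. ?I r * (fact m * (Y \<omega> * transition (r - s k) (K m r) (X (s k) \<omega>)))) \<partial>lborel)"
  proof (rule Bochner_Integration.integral_cong[OF refl])
    fix r
    show "expectation (\<lambda>\<omega>. ?I r * (Y \<omega> * (f (X' r \<omega>) * A r \<omega> ^ m)))
        = expectation (\<lambda>\<omega>. ?I r * (fact m * (Y \<omega> * transition (r - s k) (K m r) (X (s k) \<omega>))))"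
    proof (cases "r \<in> {s k<..T}")
      case True
      then have r: "s k < r" "r \<le> T" "0 \<le> r" using sk by auto
      define s' where "s' = s(Suc k := r)"
      have s': "s' i = s i" if "i \<le> k" for i using that unfolding s'_def by simp
      have s'k: "s' (Suc k) = r" unfolding s'_def by simp
      have s'_mono: "strict_mono_on {0..Suc k} s'"
        unfolding s'_def by (rule strict_mono_on_fun_upd_Suc[OF s(1) r(1)])
      have prod: "(\<Prod>i=1..Suc k. f (X (s' i) \<omega>)) = Y \<omega> * f (X r \<omega>)" for \<omega>
        unfolding Y_def using s' s'k by simp
      have [measurable]: "X r \<in> borel_measurable M" using random_variable_X r by simp
      \<comment> \<open>Fubini was applied to the jointly measurable \<open>X'\<close>; at the now
        fixed time \<open>r\<close> it may be replaced by \<open>X r\<close> up to a null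
        set.\<close>
      have "expectation (\<lambda>\<omega>. Y \<omega> * (f (X' r \<omega>) * A r \<omega> ^ m))
          = expectation (\<lambda>\<omega>. (\<Prod>i=1..Suc k. f (X (s' i) \<omega>)) * A (s' (Suc k)) \<omega> ^ m)"
        unfolding prod s'k
        by (rule integral_cong_AE) (measurable, use X'_eq_X in eventually_elim, use r in simp)
      also have "\<dots> = fact m * expectation (\<lambda>\<omega>. Y \<omega> * (f (X r \<omega>) * K m r (X r \<omega>)))"
        using Suc.IH[OF s'_mono] s'[of 0] s(2) r unfolding prod s'k by (simp add: mult.assoc)
      also have "expectation (\<lambda>\<omega>. Y \<omega> * (f (X r \<omega>) * K m r (X r \<omega>)))
          = expectation (\<lambda>\<omega>. Y \<omega> * (\<integral>z. p (r - s k) (z - X (s k) \<omega>) * (f z * K m r z) \<partial>lborel))"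
        unfolding Y_def
      proof (rule expectation_markov[where F = F and G = "F * S"])
        show "\<bar>f z * K m r z\<bar> \<le> F * S" for z
          unfolding abs_mult using f_bounded S r F_nonneg by (intro mult_mono) auto
        show "distr M borel (X (r - s k)) = density lborel (\<lambda>z. ennreal (p (r - s k) z))"
          using r by (intro p_density) auto
        show "0 \<le> p (r - s k) z" for z using r by (intro p_nonneg) auto
      qed (use s r f_bounded in auto)
      finally show ?thesis using True by (simp add: transition_def mult.assoc)
    qed simp
  qed
  also have "\<dots> = expectation (\<lambda>\<omega>. \<integral>r. ?I r * (fact m * (Y \<omega> * transition (r - s k) (K m r) (X (s k) \<omega>))) \<partial>lborel)"
  proof (rule pair.Fubini_integral[symmetric])
    have [measurable]: "(\<lambda>x. transition (fst x - s k) (K m (fst x)) (X (s k) (snd x))) \<in> borel_measurable (lborel \<Otimes>\<^sub>M M)"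
      by (rule transition_measurable[OF K_measurable]) measurable
    \<comment> \<open>Only integrability is at stake, so the increments of \<open>K m\<close> are
      bounded crudely by \<open>2 * S\<close>.\<close>
    obtain c where c: "0 \<le> c" "\<And>r z. s k < r \<Longrightarrow> \<bar>transition (r - s k) (K m r) z\<bar> \<le> \<beta> (r - s k) * c"
    proof
      show "0 \<le> 2 * S + q * S" using S0 q by simp
      fix r z assume r: "s k < r"
      have "\<bar>K m r (z + \<delta>) - K m r z\<bar> \<le> 2 * S" for z
        using S[of r z] S[of r "z + \<delta>"] r sk by linarith
      then show "\<bar>transition (r - s k) (K m r) z\<bar> \<le> \<beta> (r - s k) * (2 * S + q * S)"
        using r sk by (intro transition_bound S) auto
    qed
    show "integrable (lborel \<Otimes>\<^sub>M M) (\<lambda>(r, \<omega>). ?I r * (fact m * (Y \<omega> * transition (r - s k) (K m r) (X (s k) \<omega>))))"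
    proof (rule pair.integrable_pair_bound[where g = "\<lambda>r. ?I r * \<beta> (r - s k)" and h = "\<lambda>_. fact m * (F ^ k * c)"])
      show "(\<lambda>(r, \<omega>). ?I r * (fact m * (Y \<omega> * transition (r - s k) (K m r) (X (s k) \<omega>)))) \<in> borel_measurable (lborel \<Otimes>\<^sub>M M)"
        unfolding case_prod_beta by measurable
      show "integrable lborel (\<lambda>r. ?I r * \<beta> (r - s k))"
        using \<beta>_shift(1)[OF sk] unfolding set_integrable_def by simp
      fix r \<omega>
      have "\<bar>fact m * (Y \<omega> * transition (r - s k) (K m r) (X (s k) \<omega>))\<bar> \<le> fact m * (F ^ k * (\<beta> (r - s k) * c))"
        if "s k < r"
        unfolding abs_mult using Y_bd c(2)[OF that] F_nonneg by (intro mult_mono) auto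
      then show "\<bar>case (r, \<omega>) of (r, \<omega>) \<Rightarrow> ?I r * (fact m * (Y \<omega> * transition (r - s k) (K m r) (X (s k) \<omega>)))\<bar>
          \<le> ?I r * \<beta> (r - s k) * (fact m * (F ^ k * c))"
        by (auto split: split_indicator simp: mult_ac)
    qed auto
  qed
  also have "\<dots> = expectation (\<lambda>\<omega>. fact m * (Y \<omega> * K (Suc m) (s k) (X (s k) \<omega>)))"
    by (simp add: set_lebesgue_integral_def mult.left_commute)
  also have "\<dots> = fact m * expectation (\<lambda>\<omega>. Y \<omega> * K (Suc m) (s k) (X (s k) \<omega>))"
    by (rule integral_mult_right_zero)
  finally show ?case unfolding Y_def by (simp add: mult.assoc)
qed

lemma even_moment_bound:
  assumes "0 \<le> T"
  shows "expectation (\<lambda>\<omega>. A 0 \<omega> ^ (2 * n)) \<le> fact (2 * n) * (4 * B\<^sup>2) ^ n * q ^ n"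
proof -
  have [measurable]: "X 0 \<in> borel_measurable M" by (rule random_variable_X) simp
  have "expectation (\<lambda>\<omega>. A 0 \<omega> ^ (2 * n)) = fact (2 * n) * expectation (\<lambda>\<omega>. K (2 * n) 0 (X 0 \<omega>))"
    \<comment> \<open>With \<open>k = 0\<close> the product is empty and monotonicity on a single
      point is vacuous, which leaves the plain moment of \<open>A 0\<close>.\<close>
    using moment_formula[of 0 "\<lambda>_. 0" "2 * n"] assms by (simp add: monotone_on_def)
  also have "expectation (\<lambda>\<omega>. K (2 * n) 0 (X 0 \<omega>)) \<le> (4 * B\<^sup>2) ^ n * q ^ n"
  proof (rule integral_le_const)
    have K: "\<bar>K (2 * n) 0 z\<bar> \<le> (4 * B\<^sup>2) ^ n * q ^ n" for z using K_even_bound[of n] by simp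
    then show "integrable M (\<lambda>\<omega>. K (2 * n) 0 (X 0 \<omega>))"
      by (intro integrable_const_bound[where B = "(4 * B\<^sup>2) ^ n * q ^ n"]) auto
    show "AE \<omega> in M. K (2 * n) 0 (X 0 \<omega>) \<le> (4 * B\<^sup>2) ^ n * q ^ n"
      by (rule AE_I2) (rule abs_le_D1[OF K])
  qed
  finally show ?thesis by (simp add: mult.assoc)
qed

end

section \<open>Kolmogorov's criterion\<close>

text \<open>Level \<open>k\<close> has \<open>2 * N * 2^k\<close> increments. Their rescaled
  \<open>2 * n\<close>-th powers have total expectation at most
  \<open>2 * N * C * \<rho> ^ k\<close> with
  \<open>\<rho> = 2 powr (1 + 2 * n * \<gamma> - \<theta> * n) < 1\<close>. Hence the sum
  \<open>W\<close> over all levels is integrable, therefore finite almost surely, and it dominates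
  each single term.\<close>

lemma AE_dyadic_increments_bounded:
  fixes Z :: "real \<Rightarrow> 'a \<Rightarrow> real" and N n :: nat
  assumes [measurable]: "\<And>x. Z x \<in> borel_measurable M"
    and moment: "\<And>x \<delta>. 0 < \<delta> \<Longrightarrow> \<delta> \<le> 1 \<Longrightarrow>
      (\<integral>\<^sup>+\<omega>. ennreal ((Z x \<omega> - Z (x + \<delta>) \<omega>) ^ (2 * n)) \<partial>M) \<le> ennreal (C * (\<delta> powr \<theta>) ^ n)"
    and C: "0 \<le> C" and n: "0 < n" "1 + 2 * real n * \<gamma> < \<theta> * real n"
  shows "AE \<omega> in M. \<exists>c\<ge>0. \<forall>(k::nat) (j::int). - real N \<le> j / 2^k \<longrightarrow> (j + 1) / 2^k \<le> real N \<longrightarrow>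
           \<bar>Z ((j + 1) / 2^k) \<omega> - Z (j / 2^k) \<omega>\<bar> \<le> c * (2 powr - \<gamma>) ^ k"
proof -
  define a :: real where "a = 2 powr \<gamma>"
  have a: "0 < a" unfolding a_def by simp
  \<comment> \<open>Left end points of the cells of level \<open>k\<close> inside
    \<open>[- N, N]\<close>; the upper limit is excluded because cell \<open>j\<close> ends at
    \<open>j + 1\<close>.\<close>
  define J where "J = (\<lambda>k::nat. {- int N * 2^k..<int N * 2^k})"
  define \<Delta> where "\<Delta> = (\<lambda>k j \<omega>. (a ^ k * (Z (real_of_int j / 2^k) \<omega> - Z (real_of_int j / 2^k + 1 / 2^k) \<omega>)) ^ (2 * n))"
  define W where "W = (\<lambda>\<omega>. \<Sum>k. \<Sum>j\<in>J k. ennreal (\<Delta> k j \<omega>))"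
  define \<rho> where "\<rho> = 2 * a ^ (2 * n) * (2 powr - \<theta>) ^ n"
  have \<Delta>_nonneg: "0 \<le> \<Delta> k j \<omega>" for k j \<omega> unfolding \<Delta>_def by (simp add: power_mult)
  have [measurable]: "\<Delta> k j \<in> borel_measurable M" for k j unfolding \<Delta>_def by measurable
  have [measurable]: "W \<in> borel_measurable M" unfolding W_def by measurable
  have \<rho>: "0 \<le> \<rho>" "\<rho> < 1"
  proof -
    have "\<rho> = 2 powr (1 + 2 * real n * \<gamma> - \<theta> * real n)"
      unfolding \<rho>_def a_def by (simp add: powr_power powr_add powr_diff powr_minus mult_ac field_simps)
    then show "0 \<le> \<rho>" "\<rho> < 1" using n powr_less_mono[of "1 + 2 * real n * \<gamma> - \<theta> * real n" 0 2] by auto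
  qed
  have term_le: "(\<integral>\<^sup>+\<omega>. ennreal (\<Delta> k j \<omega>) \<partial>M) \<le> ennreal (C * (\<rho> / 2) ^ k)" for k j
  proof -
    have eq: "ennreal (\<Delta> k j \<omega>) = ennreal ((a ^ k) ^ (2 * n)) *
        ennreal ((Z (real_of_int j / 2^k) \<omega> - Z (real_of_int j / 2^k + 1 / 2^k) \<omega>) ^ (2 * n))" for \<omega>
      unfolding \<Delta>_def power_mult_distrib using a by (simp add: ennreal_mult power_mult)
    have "(\<integral>\<^sup>+\<omega>. ennreal (\<Delta> k j \<omega>) \<partial>M) = ennreal ((a ^ k) ^ (2 * n)) *
        (\<integral>\<^sup>+\<omega>. ennreal ((Z (real_of_int j / 2^k) \<omega> - Z (real_of_int j / 2^k + 1 / 2^k) \<omega>) ^ (2 * n)) \<partial>M)"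
      unfolding eq by (rule nn_integral_cmult) measurable
    also have "\<dots> \<le> ennreal ((a ^ k) ^ (2 * n)) * ennreal (C * ((1 / 2^k) powr \<theta>) ^ n)"
      by (intro mult_left_mono moment) auto
    also have "\<dots> = ennreal ((a ^ k) ^ (2 * n) * (C * ((1 / 2^k) powr \<theta>) ^ n))"
      using a C by (intro ennreal_mult[symmetric]) auto
    also have "((1 / 2^k) powr \<theta>) = (2 powr - \<theta>) ^ k"
      by (simp add: powr_powr powr_divide powr_minus_divide mult.commute flip: powr_realpow)
    also have "(a ^ k) ^ (2 * n) * (C * ((2 powr - \<theta>) ^ k) ^ n) = C * (\<rho> / 2) ^ k"
      unfolding \<rho>_def by (simp add: power_mult_distrib flip: power_mult) (simp add: mult_ac)
    finally show ?thesis .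
  qed
  have "(\<integral>\<^sup>+\<omega>. W \<omega> \<partial>M) = (\<Sum>k. \<Sum>j\<in>J k. (\<integral>\<^sup>+\<omega>. ennreal (\<Delta> k j \<omega>) \<partial>M))"
    unfolding W_def by (subst nn_integral_suminf) (auto simp: nn_integral_sum)
  also have "\<dots> \<le> (\<Sum>k. ennreal (2 * real N * C * \<rho> ^ k))"
  proof (intro suminf_le summableI)
    fix k
    have "(\<Sum>j\<in>J k. (\<integral>\<^sup>+\<omega>. ennreal (\<Delta> k j \<omega>) \<partial>M)) \<le> (\<Sum>j\<in>J k. ennreal (C * (\<rho> / 2) ^ k))"
      by (intro sum_mono term_le)
    also have "\<dots> = ennreal (\<Sum>j\<in>J k. C * (\<rho> / 2) ^ k)"
      using C \<rho> by (intro sum_ennreal) auto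
    also have "(\<Sum>j\<in>J k. C * (\<rho> / 2) ^ k) = 2 * real N * C * \<rho> ^ k"
    proof -
      have "int N * 2^k - - int N * 2^k = int (2 * N * 2^k)" by simp
      then have "card (J k) = 2 * N * 2^k" unfolding J_def card_atLeastLessThan_int by (simp only: nat_int)
      then show ?thesis by (simp add: power_divide)
    qed
    finally show "(\<Sum>j\<in>J k. (\<integral>\<^sup>+\<omega>. ennreal (\<Delta> k j \<omega>) \<partial>M)) \<le> ennreal (2 * real N * C * \<rho> ^ k)" .
  qed
  also have "\<dots> = ennreal (\<Sum>k. 2 * real N * C * \<rho> ^ k)"
    using C \<rho> by (intro suminf_ennreal2 summable_mult summable_geometric) auto
  finally have "(\<integral>\<^sup>+\<omega>. W \<omega> \<partial>M) \<noteq> \<infinity>" by (auto simp: top_unique)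
  then have "AE \<omega> in M. W \<omega> \<noteq> \<infinity>" by (intro nn_integral_PInf_AE) auto
  then show ?thesis
  proof eventually_elim
    case (elim \<omega>)
    define w where "w = enn2real (W \<omega>)"
    have w: "W \<omega> = ennreal w" "0 \<le> w" using elim unfolding w_def by (auto simp: less_top)
    have "\<bar>Z ((j + 1) / 2^k) \<omega> - Z (j / 2^k) \<omega>\<bar> \<le> (1 + w) * (2 powr - \<gamma>) ^ k"
      if j: "- real N \<le> j / 2^k" "(j + 1) / 2^k \<le> real N" for k :: nat and j :: int
    proof -
      have "real_of_int (- int N * 2^k) \<le> j" using j(1) by (simp add: field_simps)
      then have j1: "- int N * 2^k \<le> j" by (simp only: of_int_le_iff)
      have "real_of_int (j + 1) \<le> real_of_int (int N * 2^k)" using j(2) by (simp add: field_simps)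
      then have j2: "j + 1 \<le> int N * 2^k" by (simp only: of_int_le_iff)
      have "ennreal (\<Delta> k j \<omega>) \<le> (\<Sum>j\<in>J k. ennreal (\<Delta> k j \<omega>))"
        using j1 j2 by (intro member_le_sum) (simp_all add: J_def)
      also have "\<dots> \<le> W \<omega>"
        unfolding W_def using sum_le_suminf[of "\<lambda>k. \<Sum>j\<in>J k. ennreal (\<Delta> k j \<omega>)" "{k}"] by simp
      finally have le: "\<Delta> k j \<omega> \<le> w" using w by simp
      define y where "y = \<bar>a ^ k * (Z (real_of_int j / 2^k) \<omega> - Z (real_of_int j / 2^k + 1 / 2^k) \<omega>)\<bar>"
      have y: "y ^ (2 * n) \<le> w" using le unfolding \<Delta>_def y_def by (simp add: power_even_abs)
      \<comment> \<open>Avoids extracting a root: either \<open>y \<le> 1\<close>, or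
        \<open>y\<close> is at most its own \<open>2 * n\<close>-th power.\<close>
      have "y \<le> 1 + w"
      proof (cases "y \<le> 1")
        case False
        then have "y ^ 1 \<le> y ^ (2 * n)" using n by (intro power_increasing) auto
        then show ?thesis using y by simp
      qed (use w in simp)
      then have "a ^ k * \<bar>Z ((j + 1) / 2^k) \<omega> - Z (j / 2^k) \<omega>\<bar> \<le> 1 + w"
        using a unfolding y_def by (simp add: abs_mult abs_minus_commute add_divide_distrib)
      then show ?thesis
        using a unfolding powr_minus a_def[symmetric] by (simp add: power_inverse field_simps)
    qed
    then show ?case using w by (intro exI[of _ "1 + w"]) auto
  qed
qed

section \<open>Averages over shrinking intervals as approximate point evaluation\<close>

definition avg_kernel :: "nat \<Rightarrow> real \<Rightarrow> real \<Rightarrow> real" where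
  "avg_kernel k x y = real (Suc k) * indicator {x..x + 1 / real (Suc k)} y"

lemma avg_kernel_measurable [measurable]: "avg_kernel k x \<in> borel_measurable borel"
  unfolding avg_kernel_def[abs_def] by measurable

lemma avg_kernel_nonneg: "0 \<le> avg_kernel k x y"
  unfolding avg_kernel_def by simp

lemma avg_kernel_le: "\<bar>avg_kernel k x y\<bar> \<le> real (Suc k)"
  unfolding avg_kernel_def by (auto split: split_indicator)

lemma integrable_avg_kernel: "integrable lborel (avg_kernel k x)"
  unfolding avg_kernel_def[abs_def] by (intro integrable_mult_right integrable_indicat_Icc)

lemma integral_avg_kernel: "(\<integral>y. avg_kernel k x y \<partial>lborel) = 1"
  unfolding avg_kernel_def by simp

text \<open>Makes the difference \<open>f\<close> of the kernel chain a difference of averages at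
  \<open>x\<close> and at \<open>x + \<delta>\<close>.\<close>

lemma avg_kernel_shift: "avg_kernel k x (y - \<delta>) = avg_kernel k (x + \<delta>) y"
  unfolding avg_kernel_def by (auto split: split_indicator)

lemma tendsto_avg_kernel:
  fixes g :: "real \<Rightarrow> real"
  assumes g: "isCont g x" and int: "\<And>k. integrable lborel (\<lambda>y. avg_kernel k x y * g y)"
  shows "(\<lambda>k. \<integral>y. avg_kernel k x y * g y \<partial>lborel) \<longlonglongrightarrow> g x"
proof (rule LIMSEQ_I)
  fix e :: real assume e: "0 < e"
  then obtain d where d: "0 < d" "\<And>y. dist y x < d \<Longrightarrow> dist (g y) (g x) < e / 2"
    using g[unfolded continuous_at_eps_delta, rule_format, of "e / 2"] by auto
  obtain k0 :: nat where k0: "1 / d < k0" using reals_Archimedean2 by blast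
  show "\<exists>k0. \<forall>k\<ge>k0. norm ((\<integral>y. avg_kernel k x y * g y \<partial>lborel) - g x) < e"
  proof (intro exI[of _ k0] allI impI)
    fix k assume k: "k0 \<le> k"
    have small: "1 / real (Suc k) < d"
    proof -
      have "1 / d < real (Suc k)" using k k0 by linarith
      then show ?thesis using d(1) by (simp add: field_simps)
    qed
    have "(\<integral>y. avg_kernel k x y * g y \<partial>lborel) - g x = (\<integral>y. avg_kernel k x y * g y - avg_kernel k x y * g x \<partial>lborel)"
      using int integrable_avg_kernel[of k x] integral_avg_kernel[of k x] by simp
    moreover have "\<bar>\<dots>\<bar> \<le> (\<integral>y. avg_kernel k x y * (e / 2) \<partial>lborel)"
    proof (rule integral_abs_bound_integral)
      show "\<bar>avg_kernel k x y * g y - avg_kernel k x y * g x\<bar> \<le> avg_kernel k x y * (e / 2)" for y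
      proof (cases "y \<in> {x..x + 1 / real (Suc k)}")
        case True
        then have "dist y x < d" using small by (auto simp: dist_real_def)
        then have "\<bar>g y - g x\<bar> \<le> e / 2" using d(2) by (fastforce simp: dist_real_def)
        then have "avg_kernel k x y * \<bar>g y - g x\<bar> \<le> avg_kernel k x y * (e / 2)"
          using avg_kernel_nonneg by (intro mult_left_mono)
        then show ?thesis
          unfolding right_diff_distrib[symmetric] abs_mult by (simp only: abs_of_nonneg[OF avg_kernel_nonneg])
      qed (simp add: avg_kernel_def)
    qed (use int integrable_avg_kernel in auto)
    moreover have "(\<integral>y. avg_kernel k x y * (e / 2) \<partial>lborel) = e / 2"
      using integral_avg_kernel[of k x] by simp
    ultimately show "norm ((\<integral>y. avg_kernel k x y * g y \<partial>lborel) - g x) < e" using e by simp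
  qed
qed

section \<open>Increments of the local time\<close>

context symmetric_stable_process
begin

text \<open>By the occupation formula this is almost surely the mean of \<open>L t\<close> over
  \<open>[x, x + 1 / Suc k]\<close>, but written through the process alone, which makes it
  measurable in \<open>\<omega>\<close> and accessible to the moment formula.\<close>

definition smoothed_time :: "real \<Rightarrow> nat \<Rightarrow> real \<Rightarrow> 'a \<Rightarrow> real" where
  "smoothed_time t k x \<omega> = (LINT r:{0<..t}|lborel. avg_kernel k x (X' r \<omega>))"

text \<open>A stand-in for \<open>L t x\<close> that is measurable in \<open>\<omega>\<close> by
  construction; moments are computed for it, path properties for \<open>L\<close>.\<close>

definition local_time_version :: "real \<Rightarrow> real \<Rightarrow> 'a \<Rightarrow> real" where
  "local_time_version t x \<omega> = lim (\<lambda>k. smoothed_time t k x \<omega>)"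

lemma smoothed_time_measurable [measurable]: "smoothed_time t k x \<in> borel_measurable M"
proof -
  have [measurable]: "(\<lambda>y. X' (snd y) (fst y)) \<in> borel_measurable (M \<Otimes>\<^sub>M lborel)"
    using measurable_compose[OF _ X'_measurable, of "\<lambda>y. (snd y, fst y)" "M \<Otimes>\<^sub>M lborel"] by simp
  show ?thesis
    unfolding smoothed_time_def[abs_def] set_lebesgue_integral_def by measurable
qed

lemma local_time_version_measurable [measurable]: "local_time_version t x \<in> borel_measurable M"
  unfolding local_time_version_def[abs_def] by measurable

text \<open>One null set serves all \<open>x\<close>, because the occupation formula holds
  simultaneously for all bounded Borel test functions, in particular for every averaging kernel, and
  continuity of \<open>L t\<close> recovers its point values.\<close>

lemma AE_smoothed_time_tendsto:
  assumes L: "is_local_time M X L" and t: "0 \<le> t"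
  shows "AE \<omega> in M. \<forall>x. (\<lambda>k. smoothed_time t k x \<omega>) \<longlonglongrightarrow> L t x \<omega>"
  using L[unfolded is_local_time_def] X'_eq_X
proof eventually_elim
  case (elim \<omega>)
  have "continuous_on UNIV (\<lambda>x. (\<lambda>(t, x). L t x \<omega>) (t, x))"
    by (rule continuous_on_compose2[where s = UNIV and f = "\<lambda>x. (t, x)", OF conjunct1[OF elim(1)]])
       (use t in \<open>auto intro!: continuous_intros\<close>)
  then have cont: "isCont (\<lambda>x. L t x \<omega>) x" for x by (simp add: continuous_on_eq_continuous_at)
  have occ: "has_bochner_integral lborel (\<lambda>y. avg_kernel k x y * L t y \<omega>) (smoothed_time t k x \<omega>)" for k x
  proof -
    have "has_bochner_integral lborel (\<lambda>y. avg_kernel k x y * L t y \<omega>)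
        (LINT r:{0..t}|lborel. avg_kernel k x (X r \<omega>))"
    proof -
      have "bounded (range (avg_kernel k x))"
        unfolding bounded_iff using avg_kernel_le[of k x] by (intro exI[of _ "real (Suc k)"]) auto
      then show ?thesis using elim(1) t by (metis avg_kernel_measurable)
    qed
    also have "(LINT r:{0..t}|lborel. avg_kernel k x (X r \<omega>)) = (LINT r:{0..t}|lborel. avg_kernel k x (X' r \<omega>))"
      using elim by (intro set_lebesgue_integral_cong) auto
    \<comment> \<open>The occupation formula uses \<open>[0, t]\<close> and the moment recursion
      half-open time intervals; time 0 is null.\<close>
    also have "\<dots> = smoothed_time t k x \<omega>"
      unfolding smoothed_time_def by (rule set_integral_discrete_difference[where X = "{0}"]) auto
    finally show ?thesis .
  qed
  have "(\<lambda>k. \<integral>y. avg_kernel k x y * L t y \<omega> \<partial>lborel) \<longlonglongrightarrow> L t x \<omega>" for x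
    by (rule tendsto_avg_kernel[OF cont]) (use occ in \<open>auto simp: has_bochner_integral_iff\<close>)
  then show ?case using occ by (simp add: has_bochner_integral_iff)
qed

text \<open>The point is uniformity: \<open>C\<close> is built from \<open>n\<close> and the time
  integral of \<open>\<beta>\<close>, and so is chosen before \<open>k\<close>, \<open>x\<close> and
  \<open>\<delta>\<close>. The restriction \<open>\<delta> \<le> 1\<close> ensures
  \<open>q \<le> 1\<close> in the kernel chain.\<close>

lemma smoothed_time_moment_bound:
  assumes \<alpha>: "1 < \<alpha>" "\<alpha> < 2" and \<theta>: "0 < \<theta>" "\<theta> < \<alpha> - 1" and t: "0 \<le> t"
  obtains C where "0 \<le> C"
    "\<And>k x \<delta>. 0 < \<delta> \<Longrightarrow> \<delta> \<le> 1 \<Longrightarrow>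
       (\<integral>\<^sup>+\<omega>. ennreal ((smoothed_time t k x \<omega> - smoothed_time t k (x + \<delta>) \<omega>) ^ (2 * n)) \<partial>M)
         \<le> ennreal (C * (\<delta> powr \<theta>) ^ n)"
proof -
  obtain c where c: "0 < c" and char: "\<And>t u. 0 \<le> t \<Longrightarrow>
      char (distr M borel (X t)) u = complex_of_real (exp (- c * t * \<bar>u\<bar> powr \<alpha>))"
    using char_stable by blast
  obtain \<beta> where \<beta>: "\<And>r. 0 \<le> \<beta> r" "\<beta> \<in> borel_measurable borel" "\<And>t. set_integrable lborel {0<..t} \<beta>"
    and int: "\<And>r. 0 < r \<Longrightarrow> integrable lborel (\<lambda>u. exp (- c * r * \<bar>u\<bar> powr \<alpha>))"
    and bound: "\<And>r z. 0 < r \<Longrightarrow> \<bar>stable_density c \<alpha> r z\<bar> \<le> \<beta> r"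
    and inc: "\<And>r z \<delta>. 0 < r \<Longrightarrow>
       \<bar>stable_density c \<alpha> r (z + \<delta>) - stable_density c \<alpha> r z\<bar> \<le> \<bar>\<delta>\<bar> powr \<theta> * \<beta> r"
    using stable_density_bounds[OF c \<alpha> \<theta>] by metis
  define B where "B = (LINT u:{0<..t}|lborel. \<beta> u)"
  define C :: real where "C = fact (2 * n) * (4 * B\<^sup>2) ^ n"
  have dens: "distr M borel (X u) = density lborel (\<lambda>z. ennreal (stable_density c \<alpha> u z))"
    and dens_nonneg: "0 \<le> stable_density c \<alpha> u z" if u: "0 < u" for u z
  proof -
    interpret D: real_distribution "distr M borel (X u)"
      using random_variable_X[of u] u by (intro real_distribution_distr) auto
    have *: "char (distr M borel (X u)) v = complex_of_real (exp (- c * u * \<bar>v\<bar> powr \<alpha>))" for v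
      using char[of u v] u by simp
    show "distr M borel (X u) = density lborel (\<lambda>z. ennreal (stable_density c \<alpha> u z))"
      unfolding stable_density_def by (rule D.density_of_integrable_char[OF int[OF u] *])
    show "0 \<le> stable_density c \<alpha> u z"
      unfolding stable_density_def by (rule D.cos_transform_nonneg[OF int[OF u] *])
  qed
  show thesis
  proof (rule that[of C])
    show "0 \<le> C" unfolding C_def by simp
    fix k x and \<delta> :: real assume \<delta>: "0 < \<delta>" "\<delta> \<le> 1"
    interpret kernel_chain "stable_density c \<alpha>" \<beta> "avg_kernel k x" "\<delta> powr \<theta>" \<delta> t B
    proof unfold_locales
      show "\<bar>stable_density c \<alpha> u (z + \<delta>) - stable_density c \<alpha> u z\<bar> \<le> \<delta> powr \<theta> * \<beta> u" if "0 < u" for u z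
        using inc[OF that, of z \<delta>] \<delta> by simp
      show "\<delta> powr \<theta> \<le> 1" using \<delta> \<theta> by (intro powr_le1) auto
    qed (use \<beta> bound in \<open>auto simp: B_def avg_kernel_nonneg integral_avg_kernel integrable_avg_kernel\<close>)
    interpret chain: levy_kernel_chain M X "stable_density c \<alpha>" \<beta> "avg_kernel k x" "\<delta> powr \<theta>" \<delta> t B "2 * real (Suc k)"
    proof unfold_locales
      show "distr M borel (X u) = density lborel (\<lambda>z. ennreal (stable_density c \<alpha> u z))" if "0 < u" for u
        using dens[OF that] .
      show "0 \<le> stable_density c \<alpha> u z" if "0 < u" for u z
        using dens_nonneg[OF that] .
      show "\<bar>f z\<bar> \<le> 2 * real (Suc k)" for z
        unfolding f_def mult_2
        by (rule order_trans[OF abs_triangle_ineq4 add_mono[OF avg_kernel_le avg_kernel_le]])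
    qed
    have A: "chain.A 0 \<omega> = smoothed_time t k x \<omega> - smoothed_time t k (x + \<delta>) \<omega>" if "\<omega> \<in> space M" for \<omega>
    proof -
      have [measurable]: "(\<lambda>s. X' s \<omega>) \<in> borel_measurable borel" by (rule chain.X'_path_measurable[OF that])
      have int: "set_integrable lborel {0<..t} (\<lambda>r. avg_kernel k y (X' r \<omega>))" for y
        unfolding set_integrable_def
        by (rule Bochner_Integration.integrable_bound[where f = "\<lambda>r. real (Suc k) * indicator {0..t} r"])
           (use avg_kernel_le[of k y] in \<open>auto intro!: AE_I2 split: split_indicator\<close>)
      show ?thesis
        unfolding chain.A_def f_def avg_kernel_shift smoothed_time_def
        by (rule set_integral_diff(2)[OF int int])
    qed
    have "(\<integral>\<^sup>+\<omega>. ennreal ((smoothed_time t k x \<omega> - smoothed_time t k (x + \<delta>) \<omega>) ^ (2 * n)) \<partial>M)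
        = (\<integral>\<^sup>+\<omega>. ennreal (chain.A 0 \<omega> ^ (2 * n)) \<partial>M)"
      by (rule nn_integral_cong) (simp add: A)
    also have "\<dots> = ennreal (expectation (\<lambda>\<omega>. chain.A 0 \<omega> ^ (2 * n)))"
    proof (rule nn_integral_eq_integral)
      show "integrable M (\<lambda>\<omega>. chain.A 0 \<omega> ^ (2 * n))"
        by (rule integrable_const_bound[where B = "(2 * real (Suc k) * \<bar>t\<bar>) ^ (2 * n)"])
           (use chain.A_bound[of 0] in \<open>auto simp: power_abs intro!: AE_I2 power_mono\<close>)
    qed (simp add: power_mult)
    also have "\<dots> \<le> ennreal (C * (\<delta> powr \<theta>) ^ n)"
      using chain.even_moment_bound[OF t, of n] unfolding C_def by (intro ennreal_leI)
    finally show "(\<integral>\<^sup>+\<omega>. ennreal ((smoothed_time t k x \<omega> - smoothed_time t k (x + \<delta>) \<omega>) ^ (2 * n)) \<partial>M)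
         \<le> ennreal (C * (\<delta> powr \<theta>) ^ n)" .
  qed
qed

lemma local_time_moment_bound:
  assumes \<alpha>: "1 < \<alpha>" "\<alpha> < 2" and \<theta>: "0 < \<theta>" "\<theta> < \<alpha> - 1" and t: "0 \<le> t"
    and L: "is_local_time M X L"
  obtains C where "0 \<le> C"
    "\<And>x \<delta>. 0 < \<delta> \<Longrightarrow> \<delta> \<le> 1 \<Longrightarrow>
       (\<integral>\<^sup>+\<omega>. ennreal ((local_time_version t x \<omega> - local_time_version t (x + \<delta>) \<omega>) ^ (2 * n)) \<partial>M)
         \<le> ennreal (C * (\<delta> powr \<theta>) ^ n)"
proof -
  obtain C where C: "0 \<le> C" "\<And>k x \<delta>. 0 < \<delta> \<Longrightarrow> \<delta> \<le> 1 \<Longrightarrow>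
       (\<integral>\<^sup>+\<omega>. ennreal ((smoothed_time t k x \<omega> - smoothed_time t k (x + \<delta>) \<omega>) ^ (2 * n)) \<partial>M)
         \<le> ennreal (C * (\<delta> powr \<theta>) ^ n)"
    using smoothed_time_moment_bound[OF \<alpha> \<theta> t, of n] by blast
  show thesis
  proof (rule that[OF C(1)])
    fix x \<delta> :: real assume \<delta>: "0 < \<delta>" "\<delta> \<le> 1"
    let ?Z = "\<lambda>k \<omega>. (smoothed_time t k x \<omega> - smoothed_time t k (x + \<delta>) \<omega>) ^ (2 * n)"
    have "(\<integral>\<^sup>+\<omega>. ennreal ((local_time_version t x \<omega> - local_time_version t (x + \<delta>) \<omega>) ^ (2 * n)) \<partial>M)
        = (\<integral>\<^sup>+\<omega>. liminf (\<lambda>k. ennreal (?Z k \<omega>)) \<partial>M)"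
    proof (rule nn_integral_cong_AE)
      show "AE \<omega> in M. ennreal ((local_time_version t x \<omega> - local_time_version t (x + \<delta>) \<omega>) ^ (2 * n))
          = liminf (\<lambda>k. ennreal (?Z k \<omega>))"
        using AE_smoothed_time_tendsto[OF L t]
      proof eventually_elim
        case (elim \<omega>)
        then have lim: "local_time_version t y \<omega> = L t y \<omega>" for y
          unfolding local_time_version_def by (auto intro: limI)
        have "(\<lambda>k. ennreal (?Z k \<omega>)) \<longlonglongrightarrow> ennreal ((L t x \<omega> - L t (x + \<delta>) \<omega>) ^ (2 * n))"
          using elim by (intro tendsto_ennrealI tendsto_intros) auto
        then show ?case unfolding lim by (intro lim_imp_Liminf[symmetric]) auto
      qed
    qed
    also have "\<dots> \<le> liminf (\<lambda>k. \<integral>\<^sup>+\<omega>. ennreal (?Z k \<omega>) \<partial>M)"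
      by (rule nn_integral_liminf) measurable
    also have "\<dots> \<le> liminf (\<lambda>k::nat. ennreal (C * (\<delta> powr \<theta>) ^ n))"
      by (intro Liminf_mono always_eventually allI C(2) \<delta>)
    also have "\<dots> = ennreal (C * (\<delta> powr \<theta>) ^ n)" by (simp add: Liminf_const)
    finally show "(\<integral>\<^sup>+\<omega>. ennreal ((local_time_version t x \<omega> - local_time_version t (x + \<delta>) \<omega>) ^ (2 * n)) \<partial>M)
         \<le> ennreal (C * (\<delta> powr \<theta>) ^ n)" .
  qed
qed

end

theorem proposition2p6:
  fixes M :: "'a measure" and X :: "real \<Rightarrow> 'a \<Rightarrow> real"
    and L :: "real \<Rightarrow> real \<Rightarrow> 'a \<Rightarrow> real" and \<alpha> t p :: real
  assumes "1 < \<alpha>" and "\<alpha> < 2"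
    and "symmetric_stable_process M X \<alpha>"
    and "is_local_time M X L"
    and "0 \<le> t"
    and "p > 2 / (\<alpha> - 1)"
  shows "AE \<omega> in M. bounded_p_variation p (\<lambda>x. L t x \<omega>)"
proof -
  interpret symmetric_stable_process M X \<alpha> by fact
  have p: "0 < p" using assms by (smt (verit) divide_pos_pos)
  have "2 / p < \<alpha> - 1" using assms p by (simp add: field_simps)
  \<comment> \<open>The strict gap above \<open>2 / p\<close> leaves room for the additive 1 in
    Kolmogorov's condition, which counts the dyadic cells.\<close>
  then obtain \<theta> where \<theta>: "2 / p < \<theta>" "\<theta> < \<alpha> - 1" using dense by blast
  have \<theta>0: "0 < \<theta>" using \<theta> p by (smt (verit) divide_pos_pos)
  \<comment> \<open>Chosen so that \<open>n * (\<theta> - 2 / p) > 1\<close>, which is Kolmogorov's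
    condition for the Hoelder exponent \<open>1 / p\<close>.\<close>
  obtain n :: nat where n': "1 / (\<theta> - 2 / p) < n" using reals_Archimedean2 by blast
  then have n: "0 < n" "1 + 2 * real n * (1 / p) < \<theta> * real n"
  proof -
    have "0 < 1 / (\<theta> - 2 / p)" using \<theta> by simp
    then have "0 < real n" using n' by linarith
    then show "0 < n" by simp
    have "1 < real n * (\<theta> - 2 / p)" using n' \<theta> by (simp add: pos_divide_less_eq)
    then show "1 + 2 * real n * (1 / p) < \<theta> * real n" by (simp add: algebra_simps)
  qed
  obtain C where C: "0 \<le> C" "\<And>x \<delta>. 0 < \<delta> \<Longrightarrow> \<delta> \<le> 1 \<Longrightarrow>
       (\<integral>\<^sup>+\<omega>. ennreal ((local_time_version t x \<omega> - local_time_version t (x + \<delta>) \<omega>) ^ (2 * n)) \<partial>M)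
         \<le> ennreal (C * (\<delta> powr \<theta>) ^ n)"
    using local_time_moment_bound[OF assms(1,2) \<theta>0 \<theta>(2) assms(5,4)] by metis
  \<comment> \<open>All integer windows share one null set, so every compact interval is covered for
    the same \<open>\<omega>\<close>.\<close>
  have "AE \<omega> in M. \<forall>N::nat. \<exists>c\<ge>0. \<forall>(k::nat) (j::int). - real N \<le> j / 2^k \<longrightarrow> (j + 1) / 2^k \<le> real N \<longrightarrow>
      \<bar>local_time_version t ((j + 1) / 2^k) \<omega> - local_time_version t (j / 2^k) \<omega>\<bar> \<le> c * (2 powr - (1 / p)) ^ k"
    unfolding AE_all_countable
    by (intro allI AE_dyadic_increments_bounded[where \<theta> = \<theta> and C = C and n = n]) (use C n in auto)
  then show ?thesis
    using AE_smoothed_time_tendsto[OF assms(4,5)] assms(4)[unfolded is_local_time_def]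
  proof eventually_elim
    case (elim \<omega>)
    have lim: "local_time_version t y \<omega> = L t y \<omega>" for y
      using elim(2) unfolding local_time_version_def by (auto intro: limI)
    have "continuous_on UNIV (\<lambda>x. (\<lambda>(t, x). L t x \<omega>) (t, x))"
      by (rule continuous_on_compose2[where s = UNIV and f = "\<lambda>x. (t, x)", OF conjunct1[OF elim(3)]])
         (use assms(5) in \<open>auto intro!: continuous_intros\<close>)
    then have cont: "continuous_on UNIV (\<lambda>x. L t x \<omega>)" by simp
    show ?case
      unfolding bounded_p_variation_def
    proof (intro allI impI)
      fix a b :: real assume "a \<le> b"
      obtain N :: nat where N: "max \<bar>a\<bar> \<bar>b\<bar> \<le> N" using real_arch_simple by blast
      obtain c where c: "0 \<le> c" "\<And>(k::nat) (j::int). - real N \<le> j / 2^k \<Longrightarrow> (j + 1) / 2^k \<le> real N \<Longrightarrow>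
          \<bar>L t ((j + 1) / 2^k) \<omega> - L t (j / 2^k) \<omega>\<bar> \<le> c * (2 powr - (1 / p)) ^ k"
        using elim(1) unfolding lim by metis
      obtain H where H: "0 \<le> H" "\<And>x y. x \<in> {- real_of_int (int N)..int N} \<Longrightarrow> y \<in> {- real_of_int (int N)..int N} \<Longrightarrow>
          \<bar>L t x \<omega> - L t y \<omega>\<bar> \<le> H * \<bar>x - y\<bar> powr (1 / p)"
        by (rule holder_of_dyadic_increments[OF cont c(1), of "1 / p" "int N"]) (use c(2) p in auto)
      show "bounded_p_variation_on p a b (\<lambda>x. L t x \<omega>)"
      proof (rule bounded_p_variation_on_of_holder[OF p H(1)])
        show "\<bar>L t x \<omega> - L t y \<omega>\<bar> \<le> H * \<bar>x - y\<bar> powr (1 / p)" if "x \<in> {a..b}" "y \<in> {a..b}" for x y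
          using H(2)[of x y] that N by (auto simp: abs_le_iff)
      qed
    qed
  qed
qed

end
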